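(* Let $\mathbf{X}=\mathbf{Z}\odot_1\boldsymbol{\Omega}_1\cdots\odot_r\boldsymbol{\Omega}_r$ be a random tensor in $\mathbb{R}^{p_1\times\cdots\times p_r}$ with each $\boldsymbol{\Omega}_m\in\mathbb{R}^{p_m\times p_m}$ non-singular, where the components of $\mathbf{Z}$ are mutually independent with mean $0$, variance $1$ and finite fourth moments, and where, for each $m=1,\ldots,r$, the components of $\bar{\boldsymbol{\beta}}_{-m}\in\mathbb{R}^{p_m}$ are distinct, $\boldsymbol{\beta}$ being the tensor with entries $\mathrm{E}(z_{i_1\ldots i_r}^4)$. For each $m$ let $\mathbf{S}_m^{-1/2}$ be any inverse square root of $\mathbf{S}_m=\mathrm{cov}_{(m)}(\mathbf{X})$. With $\rho_m=\prod_{s\neq m}p_s$ and $\mathbf{X}^{st}=\mathbf{X}\odot_1\mathbf{S}_1^{-1/2}\cdots\odot_r\mathbf{S}_r^{-1/2}$, let $$\mathbf{B}_m^0=\rho_m^{-1}\mathrm{E}\{(\mathbf{X}^{st}\odot_{-m}\mathbf{X}^{st})^2\},\qquad \mathbf{B}_m^1=\rho_m^{-1}\mathrm{E}\{\|\mathbf{X}^{st}\|_F^2(\mathbf{X}^{st}\odot_{-m}\mathbf{X}^{st})\},$$ and let $\mathbf{W}_m$ be an orthogonal matrix having the eigenvectors of either $\mathbf{B}_m^0$ or $\mathbf{B}_m^1$ as its columns, $m=1,\ldots,r$. Then $$\mathbf{X}\odot_1(\mathbf{W}_1^\top\mathbf{S}_1^{-1/2})\cdots\odot_r(\mathbf{W}_r^\top\mathbf{S}_r^{-1/2})=\tau\,\mathbf{Z}$$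 up to permutations and sign changes in each mode; that is, there are $p_m\times p_m$ permutation matrices $\mathbf{P}_m$ and diagonal matrices $\mathbf{J}_m$ with diagonal entries $\pm1$, $m=1,\ldots,r$, such that the left-hand side equals $\tau\,\mathbf{Z}\odot_1(\mathbf{P}_1\mathbf{J}_1)\cdots\odot_r(\mathbf{P}_r\mathbf{J}_r)$. Here $\tau=\prod_{m=1}^r\prod_{s\neq m}p_s^{1/2}\|\mathbf{D}_s\|_F^{-1}$, where $\mathbf{D}_s$ is the diagonal matrix of singular values of $\boldsymbol{\Omega}_s$.
   Context: Tensor-matrix product: for $\mathbf{A}\in\mathbb{R}^{p_1\times\cdots\times p_r}$ and $\mathbf{B}\in\mathbb{R}^{q_m\times p_m}$, $\mathbf{A}\odot_m\mathbf{B}$ is the tensor with entries $(\mathbf{A}\odot_m\mathbf{B})_{i_1\ldots j_m\ldots i_r}=\sum_{i_m}a_{i_1\ldots i_m\ldots i_r}b_{j_m i_m}$. Successive products are applied from left to right. $m$-mode product of two tensors: $\mathbf{A}\odot_{-m}\mathbf{B}$ is the $p_m\times p_m$ matrix whose $(s,t)$ entry is $\sum a_{i_1\ldots i_{m-1}\,s\,i_{m+1}\ldots i_r}\,b_{i_1\ldots i_{m-1}\,t\,i_{m+1}\ldots i_r}$, summed over all $i_j$, $j\neq m$. For a zero-mean random tensor, $\mathrm{cov}_{(m)}(\mathbf{X})=\big(\prod_{s\neq m}p_s\big)^{-1}\mathrm{E}(\mathbf{X}\odot_{-m}\mathbf{X})$. For a tensor $\mathbf{A}\in\mathbb{R}^{p_1\times\cdots\times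 p_r}$, $\bar{\mathbf{A}}_{-m}$ is the $p_m$-vector whose $i_m$th element is the mean of all elements of $\mathbf{A}$ whose $m$th index equals $i_m$. $\|\cdot\|_F$ is the Frobenius norm ($\|\cdot\|_F^2$ is the sum of squared elements). An inverse square root of a symmetric positive definite $\mathbf{S}$ is any $\mathbf{G}$ with $\mathbf{G}\mathbf{S}\mathbf{G}^\top=\mathbf{I}$. *)

theory Defs
  imports "HOL-Probability.Probability" "Jordan_Normal_Form.Char_Poly"
begin

text \<open>
  A tensor of dimensions \<open>p 0 \<times> \<dots> \<times> p (r - 1)\<close> is a function on multi-indices
  \<open>i :: nat \<Rightarrow> nat\<close>. Modes and indices are counted from 0, so that \<open>m < r\<close> and \<open>i m < p m\<close>.
  Only the values on \<open>tensor_idx {..<r} p\<close> are meaningful, and two tensors are considered equal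
  if they agree there.
\<close>

type_synonym multi_index = "nat \<Rightarrow> nat"
type_synonym tensor = "multi_index \<Rightarrow> real"

definition tensor_idx :: "nat set \<Rightarrow> (nat \<Rightarrow> nat) \<Rightarrow> multi_index set" where
  "tensor_idx I p = (\<Pi>\<^sub>E m\<in>I. {..<p m})"

text \<open>The dimension of mode \<open>m\<close> of \<open>A\<close> is \<open>dim_col B\<close>; that of the product is \<open>dim_row B\<close>.\<close>

definition tensor_mat_prod :: "nat \<Rightarrow> tensor \<Rightarrow> real mat \<Rightarrow> tensor" where
  "tensor_mat_prod m A B = (\<lambda>j. \<Sum>k<dim_col B. A (j(m := k)) * B $$ (j m, k))"

text \<open>The successive products in the modes \<open>0, \<dots>, r - 1\<close>, applied from left to right.\<close>

primrec tensor_mat_prods :: "nat \<Rightarrow> tensor \<Rightarrow> (nat \<Rightarrow> real mat) \<Rightarrow> tensor" where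
  "tensor_mat_prods 0 A B = A"
| "tensor_mat_prods (Suc m) A B = tensor_mat_prod m (tensor_mat_prods m A B) (B m)"

definition mode_prod :: "nat \<Rightarrow> (nat \<Rightarrow> nat) \<Rightarrow> nat \<Rightarrow> tensor \<Rightarrow> tensor \<Rightarrow> real mat" where
  "mode_prod r p m A B = mat (p m) (p m)
     (\<lambda>(s, t). \<Sum>i\<in>tensor_idx ({..<r} - {m}) p. A (i(m := s)) * B (i(m := t)))"

definition codim :: "nat \<Rightarrow> (nat \<Rightarrow> nat) \<Rightarrow> nat \<Rightarrow> real" where
  "codim r p m = (\<Prod>s\<in>{..<r} - {m}. real (p s))"

definition mode_mean :: "nat \<Rightarrow> (nat \<Rightarrow> nat) \<Rightarrow> nat \<Rightarrow> tensor \<Rightarrow> real vec" where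
  "mode_mean r p m A = Matrix.vec (p m)
     (\<lambda>k. (\<Sum>i\<in>{i \<in> tensor_idx {..<r} p. i m = k}. A i) /
          real (card {i \<in> tensor_idx {..<r} p. i m = k}))"

definition tensor_frob :: "nat \<Rightarrow> (nat \<Rightarrow> nat) \<Rightarrow> tensor \<Rightarrow> real" where
  "tensor_frob r p A = sqrt (\<Sum>i\<in>tensor_idx {..<r} p. (A i)\<^sup>2)"

definition mat_frob :: "real mat \<Rightarrow> real" where
  "mat_frob A = sqrt (\<Sum>i<dim_row A. \<Sum>j<dim_col A. (A $$ (i, j))\<^sup>2)"

definition mat_expectation :: "'w measure \<Rightarrow> nat \<Rightarrow> ('w \<Rightarrow> real mat) \<Rightarrow> real mat" where
  "mat_expectation M n Y = mat n n (\<lambda>(s, t). \<integral>\<omega>. Y \<omega> $$ (s, t) \<partial>M)"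

text \<open>The expectation is not subtracted: \<open>mode_cov\<close> is meant for zero-mean tensors only.\<close>

definition mode_cov ::
  "'w measure \<Rightarrow> nat \<Rightarrow> (nat \<Rightarrow> nat) \<Rightarrow> nat \<Rightarrow> ('w \<Rightarrow> tensor) \<Rightarrow> real mat" where
  "mode_cov M r p m Y =
     (1 / codim r p m) \<cdot>\<^sub>m mat_expectation M (p m) (\<lambda>\<omega>. mode_prod r p m (Y \<omega>) (Y \<omega>))"

definition mode_B0 ::
  "'w measure \<Rightarrow> nat \<Rightarrow> (nat \<Rightarrow> nat) \<Rightarrow> nat \<Rightarrow> ('w \<Rightarrow> tensor) \<Rightarrow> real mat" where
  "mode_B0 M r p m Y =
     (1 / codim r p m) \<cdot>\<^sub>m
       mat_expectation M (p m) (\<lambda>\<omega>. mode_prod r p m (Y \<omega>) (Y \<omega>) ^\<^sub>m 2)"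

definition mode_B1 ::
  "'w measure \<Rightarrow> nat \<Rightarrow> (nat \<Rightarrow> nat) \<Rightarrow> nat \<Rightarrow> ('w \<Rightarrow> tensor) \<Rightarrow> real mat" where
  "mode_B1 M r p m Y =
     (1 / codim r p m) \<cdot>\<^sub>m
       mat_expectation M (p m)
         (\<lambda>\<omega>. (tensor_frob r p (Y \<omega>))\<^sup>2 \<cdot>\<^sub>m mode_prod r p m (Y \<omega>) (Y \<omega>))"

text \<open>
  The library's \<open>Matrix.orthogonal_mat\<close> only requires the columns to be nonzero and pairwise
  orthogonal, and so does not express the notion needed here.
\<close>

definition is_orthogonal_mat :: "nat \<Rightarrow> real mat \<Rightarrow> bool" where
  "is_orthogonal_mat n W \<longleftrightarrow> W \<in> carrier_mat n n \<and> W\<^sup>T * W = 1\<^sub>m n"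

definition is_inverse_sqrt :: "nat \<Rightarrow> real mat \<Rightarrow> real mat \<Rightarrow> bool" where
  "is_inverse_sqrt n S G \<longleftrightarrow> G \<in> carrier_mat n n \<and> G * S * G\<^sup>T = 1\<^sub>m n"

definition columns_eigenvectors :: "real mat \<Rightarrow> real mat \<Rightarrow> bool" where
  "columns_eigenvectors B W \<longleftrightarrow> (\<forall>j<dim_col W. \<exists>k. eigenvector B (col W j) k)"

text \<open>
  \<open>D\<close> is the middle factor of a singular value decomposition of \<open>A\<close>. This determines \<open>D\<close> up to
  the order of its diagonal entries.
\<close>

definition is_singular_value_mat :: "nat \<Rightarrow> real mat \<Rightarrow> real mat \<Rightarrow> bool" where
  "is_singular_value_mat n A D \<longleftrightarrow>
     D \<in> carrier_mat n n \<and> diagonal_mat D \<and> (\<forall>i<n. 0 \<le> D $$ (i, i)) \<and>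
     (\<exists>U V. is_orthogonal_mat n U \<and> is_orthogonal_mat n V \<and> A = U * D * V\<^sup>T)"

definition is_permutation_mat :: "nat \<Rightarrow> real mat \<Rightarrow> bool" where
  "is_permutation_mat n P \<longleftrightarrow>
     (\<exists>\<pi>. \<pi> permutes {..<n} \<and> P = mat n n (\<lambda>(i, j). if i = \<pi> j then 1 else 0))"

definition is_sign_mat :: "nat \<Rightarrow> real mat \<Rightarrow> bool" where
  "is_sign_mat n J \<longleftrightarrow>
     J \<in> carrier_mat n n \<and> diagonal_mat J \<and> (\<forall>i<n. J $$ (i, i) = 1 \<or> J $$ (i, i) = -1)"

end

theory Submission
  imports Defs
begin

text \<open>
  By independence, the \<open>m\<close>-mode covariance of \<open>X\<close> is \<open>1 / (a m)\<^sup>2\<close> times \<open>\<Omega> m * (\<Omega> m)\<^sup>T\<close> for some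
  \<open>a m > 0\<close>, so that \<open>G m * \<Omega> m\<close> is \<open>a m\<close> times an orthogonal matrix \<open>U m\<close>, and the standardized
  tensor is \<open>\<tau> Z\<close> rotated by \<open>U m\<close> in each mode, where \<open>\<tau>\<close> is the product of the \<open>a m\<close>. Rotations in
  the other modes cancel in the \<open>m\<close>-mode product. Hence both fourth-moment matrices have the form
  \<open>U m * \<Lambda> * (U m)\<^sup>T\<close>; here \<open>\<Lambda>\<close> is diagonal, because each monomial contributing to an off-diagonal
  entry contains some component of \<open>Z\<close> exactly once, and its diagonal is an injective affine function
  of the mode means of the fourth moments. As these are distinct, the eigenvectors are unique up to
  order and sign, that is, \<open>(W m)\<^sup>T * U m\<close> is a signed permutation matrix.
\<close>

section \<open>Tensor-matrix products as multiple sums\<close>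

text \<open>Each \<open>i\<close> is \<open>undefined\<close> at \<open>m\<close>, so the pair
  \<open>(k, i)\<close> can be read off from \<open>i(m := k)\<close>.\<close>

lemma sum_tensor_idx_insert:
  fixes f :: "multi_index \<Rightarrow> real"
  assumes "m \<notin> I"
  shows "(\<Sum>i\<in>tensor_idx (insert m I) p. f i) = (\<Sum>i\<in>tensor_idx I p. \<Sum>k<p m. f (i(m := k)))"
proof -
  have "inj_on (\<lambda>(k, i). i(m := k)) ({..<p m} \<times> tensor_idx I p)"
    unfolding tensor_idx_def using assms by (rule inj_combinator)
  then have "(\<Sum>i\<in>tensor_idx (insert m I) p. f i) =
      (\<Sum>(k, i)\<in>{..<p m} \<times> tensor_idx I p. f (i(m := k)))"
    unfolding tensor_idx_def PiE_insert_eq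
    by (subst sum.reindex) (auto simp: case_prod_beta)
  then show ?thesis
    by (simp add: sum.cartesian_product[symmetric] sum.swap[of _ _ "tensor_idx I p"])
qed

lemma finite_tensor_idx [simp]: "finite I \<Longrightarrow> finite (tensor_idx I p)"
  unfolding tensor_idx_def by (intro finite_PiE) auto

lemma card_tensor_idx: "finite I \<Longrightarrow> card (tensor_idx I p) = (\<Prod>m\<in>I. p m)"
  unfolding tensor_idx_def by (simp add: card_PiE)

lemma tensor_idx_less: "i \<in> tensor_idx I p \<Longrightarrow> m \<in> I \<Longrightarrow> i m < p m"
  unfolding tensor_idx_def by auto

lemma tensor_idx_upd:
  assumes "i \<in> tensor_idx (I - {m}) p" "m \<in> I" "k < p m"
  shows "i(m := k) \<in> tensor_idx I p"
  using assms unfolding tensor_idx_def by (auto simp: PiE_iff extensional_def)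

lemma sum_tensor_idx_split:
  fixes f :: "multi_index \<Rightarrow> real"
  assumes "m < r"
  shows "(\<Sum>i\<in>tensor_idx {..<r} p. f i) =
    (\<Sum>k<p m. \<Sum>i\<in>tensor_idx ({..<r} - {m}) p. f (i(m := k)))"
  using sum_tensor_idx_insert[of m "{..<r} - {m}" f p] assms
  by (simp add: insert_absorb sum.swap[of _ _ "tensor_idx ({..<r} - {m}) p"])

lemma sum_tensor_idx_prod:
  fixes f :: "nat \<Rightarrow> nat \<Rightarrow> real"
  assumes "finite I"
  shows "(\<Sum>i\<in>tensor_idx I p. \<Prod>m\<in>I. f m (i m)) = (\<Prod>m\<in>I. \<Sum>k<p m. f m k)"
  unfolding tensor_idx_def using assms by (subst prod_sum_PiE) auto

text \<open>After \<open>n\<close> products only the first \<open>n\<close> modes are contracted, so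
  \<open>A\<close> is still evaluated at \<open>j\<close> in all later modes. This mixed index is
  what lets the induction go through for arbitrary \<open>j\<close>.\<close>

lemma tensor_mat_prods_partial:
  assumes "\<And>m. m < n \<Longrightarrow> dim_col (B m) = p m"
  shows "tensor_mat_prods n A B j =
    (\<Sum>k\<in>tensor_idx {..<n} p. A (\<lambda>m. if m < n then k m else j m) * (\<Prod>m<n. B m $$ (j m, k m)))"
  using assms
proof (induction n arbitrary: j)
  case 0
  then show ?case by (simp add: tensor_idx_def)
next
  case (Suc n)
  \<comment> \<open>The product in mode \<open>n\<close> evaluates the earlier ones at
    \<open>j(n := c)\<close>; the value \<open>c\<close> can be carried by the summation index
    \<open>k\<close> instead.\<close>
  have upd: "(\<lambda>m. if m < n then k m else (j(n := c)) m) =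
      (\<lambda>m. if m < Suc n then (k(n := c)) m else j m)" for k j :: multi_index and c
    by (auto simp: fun_eq_iff less_Suc_eq)
  have pr: "(\<Prod>m<n. B m $$ ((j(n := c)) m, k m)) = (\<Prod>m<n. B m $$ (j m, (k(n := c)) m))"
    for k j :: multi_index and c
    by (intro prod.cong) auto
  have "tensor_mat_prods (Suc n) A B j = (\<Sum>c<p n. \<Sum>k\<in>tensor_idx {..<n} p.
      A (\<lambda>m. if m < Suc n then (k(n := c)) m else j m) *
      (\<Prod>m<Suc n. B m $$ (j m, (k(n := c)) m)))"
    using Suc by (simp add: tensor_mat_prod_def upd pr sum_distrib_right mult.assoc del: fun_upd_apply)
      (simp)
  also have "\<dots> = (\<Sum>k\<in>tensor_idx {..<Suc n} p. A (\<lambda>m. if m < Suc n then k m else j m) *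
      (\<Prod>m<Suc n. B m $$ (j m, k m)))"
    by (subst sum.swap) (simp add: lessThan_Suc sum_tensor_idx_insert del: fun_upd_apply)
  finally show ?case .
qed

lemma tensor_mat_prods_eq:
  assumes "\<And>m. m < r \<Longrightarrow> dim_col (B m) = p m" and "j \<in> tensor_idx {..<r} q"
  shows "tensor_mat_prods r A B j =
    (\<Sum>k\<in>tensor_idx {..<r} p. A k * (\<Prod>m<r. B m $$ (j m, k m)))"
proof -
  \<comment> \<open>Outside \<open>{..<r}\<close> both multi-indices are \<open>undefined\<close>,
    so filling up \<open>k\<close> with \<open>j\<close> changes nothing.\<close>
  have "(\<lambda>m. if m < r then k m else j m) = k" if "k \<in> tensor_idx {..<r} p" for k
    using that assms(2) by (auto simp: tensor_idx_def PiE_iff extensional_def fun_eq_iff)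
  then show ?thesis
    by (simp add: tensor_mat_prods_partial[where p = p] assms(1))
qed

lemma index_mult_mat_sum:
  assumes "A \<in> carrier_mat l n" "B \<in> carrier_mat n k" "i < l" "j < k"
  shows "(A * B) $$ (i, j) = (\<Sum>c<n. A $$ (i, c) * B $$ (c, j))"
  using assms by (auto simp: scalar_prod_def lessThan_atLeast0)

text \<open>Summing over the intermediate multi-index \<open>k\<close> factorises over the modes,
  and each factor is an entry of \<open>C m * B m\<close>. \<open>Y\<close> is evaluated only on
  \<open>tensor_idx {..<r} q\<close>, so agreement with the first product is asked for only
  there.\<close>

lemma tensor_mat_prods_compose:
  assumes "\<And>m. m < r \<Longrightarrow> B m \<in> carrier_mat (q m) (p m)"
    and "\<And>m. m < r \<Longrightarrow> C m \<in> carrier_mat (s m) (q m)"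
    and "\<And>i. i \<in> tensor_idx {..<r} q \<Longrightarrow> Y i = tensor_mat_prods r A B i"
    and j: "j \<in> tensor_idx {..<r} s"
  shows "tensor_mat_prods r Y C j = tensor_mat_prods r A (\<lambda>m. C m * B m) j"
proof -
  have "tensor_mat_prods r Y C j = (\<Sum>k\<in>tensor_idx {..<r} q. Y k * (\<Prod>m<r. C m $$ (j m, k m)))"
    using assms(2) j by (intro tensor_mat_prods_eq) auto
  also have "\<dots> = (\<Sum>k\<in>tensor_idx {..<r} q. \<Sum>l\<in>tensor_idx {..<r} p.
      A l * (\<Prod>m<r. C m $$ (j m, k m) * B m $$ (k m, l m)))"
  proof (intro sum.cong refl)
    fix k assume k: "k \<in> tensor_idx {..<r} q"
    then have "Y k = (\<Sum>l\<in>tensor_idx {..<r} p. A l * (\<Prod>m<r. B m $$ (k m, l m)))"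
      using assms(1,3) by (subst tensor_mat_prods_eq[symmetric]) auto
    then show "Y k * (\<Prod>m<r. C m $$ (j m, k m)) = (\<Sum>l\<in>tensor_idx {..<r} p.
        A l * (\<Prod>m<r. C m $$ (j m, k m) * B m $$ (k m, l m)))"
      by (simp add: sum_distrib_right prod.distrib) (simp add: mult_ac)
  qed
  also have "\<dots> = (\<Sum>l\<in>tensor_idx {..<r} p.
      A l * (\<Prod>m<r. \<Sum>c<q m. C m $$ (j m, c) * B m $$ (c, l m)))"
    by (subst sum.swap) (simp add: sum_distrib_left[symmetric]
        sum_tensor_idx_prod[of _ "\<lambda>m c. C m $$ (j m, c) * B m $$ (c, _ m)"])
  also have "\<dots> = (\<Sum>l\<in>tensor_idx {..<r} p. A l * (\<Prod>m<r. (C m * B m) $$ (j m, l m)))"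
  proof (intro sum.cong refl arg_cong2[where f = "(*)"] prod.cong)
    fix l m assume "l \<in> tensor_idx {..<r} p" "m \<in> {..<r}"
    then show "(\<Sum>c<q m. C m $$ (j m, c) * B m $$ (c, l m)) = (C m * B m) $$ (j m, l m)"
      using assms(1,2)[of m] j by (subst index_mult_mat_sum) (auto dest: tensor_idx_less)
  qed
  also have "\<dots> = tensor_mat_prods r A (\<lambda>m. C m * B m) j"
    using assms(1) j by (intro tensor_mat_prods_eq[symmetric]) (auto simp: carrier_matD)
  finally show ?thesis .
qed

text \<open>Every summand contains exactly one entry of each \<open>B m\<close>, so the scalars of
  all modes come out as a single product.\<close>

lemma tensor_mat_prods_smult:
  assumes "\<And>m. m < r \<Longrightarrow> B m \<in> carrier_mat (q m) (p m)" "j \<in> tensor_idx {..<r} q"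
  shows "tensor_mat_prods r (\<lambda>k. (\<Prod>m<r. a m) * A k) B j =
    tensor_mat_prods r A (\<lambda>m. a m \<cdot>\<^sub>m B m) j"
proof -
  have "(\<Prod>m<r. (a m \<cdot>\<^sub>m B m) $$ (j m, k m)) = (\<Prod>m<r. a m) * (\<Prod>m<r. B m $$ (j m, k m))"
    if "k \<in> tensor_idx {..<r} p" for k
    unfolding prod.distrib[symmetric]
  proof (intro prod.cong refl)
    fix m assume m: "m \<in> {..<r}"
    then show "(a m \<cdot>\<^sub>m B m) $$ (j m, k m) = a m * B m $$ (j m, k m)"
      using assms(1)[of m] tensor_idx_less[OF assms(2) m] tensor_idx_less[OF that m] by auto
  qed
  then have "(\<Sum>k\<in>tensor_idx {..<r} p. A k * (\<Prod>m<r. (a m \<cdot>\<^sub>m B m) $$ (j m, k m))) =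
      (\<Sum>k\<in>tensor_idx {..<r} p. (\<Prod>m<r. a m) * A k * (\<Prod>m<r. B m $$ (j m, k m)))"
    by (intro sum.cong refl) (simp only: mult_ac)
  moreover have d: "dim_col (B m) = p m" "dim_col (a m \<cdot>\<^sub>m B m) = p m" if "m < r" for m
    using assms(1)[OF that] by auto
  ultimately show ?thesis
    by (simp only: tensor_mat_prods_eq[OF d(1) assms(2)] tensor_mat_prods_eq[OF d(2) assms(2)])
qed

section \<open>Orthogonal matrices\<close>

lemma index_congruence_mat:
  assumes "U \<in> carrier_mat n n" "Q \<in> carrier_mat n n" "s < n" "t < n"
  shows "(U * Q * U\<^sup>T) $$ (s, t) = (\<Sum>u<n. \<Sum>v<n. U $$ (s, u) * Q $$ (u, v) * U $$ (t, v))"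
proof -
  have "(U * Q * U\<^sup>T) $$ (s, t) = (\<Sum>v<n. (U * Q) $$ (s, v) * U $$ (t, v))"
    using assms by (subst index_mult_mat_sum[of _ n n _ n]) auto
  also have "\<dots> = (\<Sum>v<n. \<Sum>u<n. U $$ (s, u) * Q $$ (u, v) * U $$ (t, v))"
    using assms by (simp add: index_mult_mat_sum[of U n n Q n] sum_distrib_right del: index_mult_mat)
  finally show ?thesis by (subst sum.swap)
qed

lemma transpose_mult_self_index:
  assumes "A \<in> carrier_mat n k" "i < k" "j < k"
  shows "(A\<^sup>T * A) $$ (i, j) = (\<Sum>c<n. A $$ (c, i) * A $$ (c, j))"
  using assms by (subst index_mult_mat_sum[of _ k n]) auto

lemma is_orthogonal_matD:
  assumes "is_orthogonal_mat n U"
  shows "U \<in> carrier_mat n n" "U\<^sup>T * U = 1\<^sub>m n" "U * U\<^sup>T = 1\<^sub>m n"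
  using assms mat_mult_left_right_inverse[of "U\<^sup>T" n U]
  by (auto simp: is_orthogonal_mat_def)

lemma orthogonal_columns:
  assumes "is_orthogonal_mat n U" "i < n" "j < n"
  shows "(\<Sum>c<n. U $$ (c, i) * U $$ (c, j)) = of_bool (i = j)"
  using transpose_mult_self_index[of U n n i j] is_orthogonal_matD[OF assms(1)] assms by auto

lemma is_orthogonal_mat_transpose: "is_orthogonal_mat n U \<Longrightarrow> is_orthogonal_mat n U\<^sup>T"
  unfolding is_orthogonal_mat_def[of n "U\<^sup>T"] by (simp add: is_orthogonal_matD)

lemma is_orthogonal_mat_mult:
  assumes "is_orthogonal_mat n U" "is_orthogonal_mat n V"
  shows "is_orthogonal_mat n (U * V)"
proof -
  note U = is_orthogonal_matD[OF assms(1)] and V = is_orthogonal_matD[OF assms(2)]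
  have "(U * V)\<^sup>T * (U * V) = V\<^sup>T * (U\<^sup>T * (U * V))"
    using U V by (subst transpose_mult[of _ n n]) (auto intro!: assoc_mult_mat[of _ n n _ n _ n])
  also have "U\<^sup>T * (U * V) = V"
    using U V by (subst assoc_mult_mat[of _ n n _ n _ n, symmetric]) auto
  finally show ?thesis
    using U V by (auto simp: is_orthogonal_mat_def)
qed

section \<open>Frobenius norms and singular values\<close>

lemma mat_frob_transpose: "mat_frob A\<^sup>T = mat_frob A"
  unfolding mat_frob_def by (simp, subst sum.swap) simp

text \<open>The Gram matrix \<open>A\<^sup>T * A\<close> does not see \<open>U\<close>, and its
  diagonal holds the squared column norms.\<close>

lemma mat_frob_orthogonal_mult:
  assumes "is_orthogonal_mat n U" "A \<in> carrier_mat n k"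
  shows "mat_frob (U * A) = mat_frob A"
proof -
  note U = is_orthogonal_matD[OF assms(1)]
  have "(U * A)\<^sup>T * (U * A) = A\<^sup>T * (U\<^sup>T * (U * A))"
    using U assms(2) by (subst transpose_mult[of _ n n _ k])
      (auto intro!: assoc_mult_mat[of _ k n _ n _ k])
  also have "U\<^sup>T * (U * A) = A"
    using U assms(2) by (subst assoc_mult_mat[of _ n n _ n _ k, symmetric]) auto
  finally have eq: "(U * A)\<^sup>T * (U * A) = A\<^sup>T * A" .
  have "(\<Sum>i<n. ((U * A) $$ (i, j))\<^sup>2) = (\<Sum>i<n. (A $$ (i, j))\<^sup>2)" if "j < k" for j
    using transpose_mult_self_index[of "U * A" n k j j] transpose_mult_self_index[of A n k j j]
      eq U assms(2) that by (simp add: power2_eq_square)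
  then have "(\<Sum>j<k. \<Sum>i<n. ((U * A) $$ (i, j))\<^sup>2) = (\<Sum>j<k. \<Sum>i<n. (A $$ (i, j))\<^sup>2)"
    by simp
  then have "(\<Sum>i<n. \<Sum>j<k. ((U * A) $$ (i, j))\<^sup>2) = (\<Sum>i<n. \<Sum>j<k. (A $$ (i, j))\<^sup>2)"
    by (simp only: sum.swap[of _ "{..<n}" "{..<k}"])
  moreover have "dim_row (U * A) = n" "dim_col (U * A) = k" "dim_row A = n" "dim_col A = k"
    using U assms(2) by auto
  ultimately show ?thesis unfolding mat_frob_def by (simp only:)
qed

text \<open>Both orthogonal factors drop out of the norm, the right one after transposing. The norms
  of \<open>D s\<close> in \<open>\<tau>\<close> can thus be traded for those of
  \<open>\<Omega> s\<close>, which arise from the covariance.\<close>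

lemma mat_frob_singular_value_mat:
  assumes "is_singular_value_mat n A D"
  shows "mat_frob D = mat_frob A"
proof -
  obtain U V where D: "D \<in> carrier_mat n n" and U: "is_orthogonal_mat n U"
    and V: "is_orthogonal_mat n V" and A: "A = U * D * V\<^sup>T"
    using assms unfolding is_singular_value_mat_def by blast
  note c = D is_orthogonal_matD(1)[OF U] is_orthogonal_matD(1)[OF V]
  have "mat_frob A = mat_frob (U * (D * V\<^sup>T))"
    using c unfolding A by (subst assoc_mult_mat[of _ n n _ n _ n]) auto
  also have "\<dots> = mat_frob ((V * D\<^sup>T)\<^sup>T)"
    using c U by (subst mat_frob_orthogonal_mult[of n _ _ n])
      (auto simp: transpose_mult[of V n n "D\<^sup>T" n])
  also have "\<dots> = mat_frob D"
    using c V by (simp add: mat_frob_transpose mat_frob_orthogonal_mult[of n _ _ n])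
  finally show ?thesis by simp
qed

lemma mat_frob_pos:
  assumes "A \<in> carrier_mat n n" "invertible_mat A" "1 \<le> n"
  shows "0 < mat_frob A"
proof -
  obtain B where "inverts_mat A B" "inverts_mat B A"
    using assms(2) unfolding invertible_mat_def by blast
  then have AB: "A * B = 1\<^sub>m n" and BA: "B * A = 1\<^sub>m (dim_row B)"
    using assms(1) by (auto simp: inverts_mat_def)
  \<comment> \<open>\<open>inverts_mat\<close> leaves the shape of \<open>B\<close> open; it is read
    off from the two identities.\<close>
  have "dim_col (A * B) = n" "dim_col (B * A) = dim_row B" by (simp_all only: AB BA index_one_mat)
  then have B: "B \<in> carrier_mat n n" using assms(1) by auto
  have "\<exists>i<n. \<exists>j<n. A $$ (i, j) \<noteq> 0"
  proof (rule ccontr)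
    assume "\<not> ?thesis"
    then have "A = 0\<^sub>m n n" using assms(1) by (intro eq_matI) auto
    then have "(A * B) $$ (0, 0) = 0"
      using assms(3) B by simp
    then show False using AB assms(3) by auto
  qed
  then obtain i j where ij: "i < n" "j < n" "A $$ (i, j) \<noteq> 0" by auto
  have "0 < (A $$ (i, j))\<^sup>2" using ij by simp
  also have "\<dots> \<le> (\<Sum>j<n. (A $$ (i, j))\<^sup>2)"
    using ij by (intro member_le_sum) auto
  also have "\<dots> \<le> (\<Sum>i<n. \<Sum>j<n. (A $$ (i, j))\<^sup>2)"
    using ij by (intro member_le_sum[of i "{..<n}" "\<lambda>i. \<Sum>j<n. (A $$ (i, j))\<^sup>2"]) (auto intro: sum_nonneg)
  finally show ?thesis using assms(1) by (simp add: mat_frob_def)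
qed

text \<open>After exchanging the sums, the columns of \<open>U\<close> contribute Kronecker deltas.
  This trace invariance frees the squared norm in \<open>mode_B1\<close> from the rotation.\<close>

lemma sum_congruence_diag:
  assumes "is_orthogonal_mat n U" "Q \<in> carrier_mat n n"
  shows "(\<Sum>s<n. (U * Q * U\<^sup>T) $$ (s, s)) = (\<Sum>s<n. Q $$ (s, s))"
proof -
  note U = is_orthogonal_matD[OF assms(1)]
  have "(\<Sum>s<n. (U * Q * U\<^sup>T) $$ (s, s)) =
      (\<Sum>s<n. \<Sum>u<n. \<Sum>v<n. U $$ (s, u) * Q $$ (u, v) * U $$ (s, v))"
    using U assms(2) by (intro sum.cong refl index_congruence_mat) auto
  also have "\<dots> = (\<Sum>u<n. \<Sum>v<n. Q $$ (u, v) * (\<Sum>s<n. U $$ (s, u) * U $$ (s, v)))"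
    by (subst sum.swap, rule sum.cong[OF refl], subst sum.swap) (simp add: sum_distrib_left mult_ac)
  also have "\<dots> = (\<Sum>u<n. \<Sum>v<n. Q $$ (u, v) * of_bool (u = v))"
    using assms(1) by (simp add: orthogonal_columns)
  also have "\<dots> = (\<Sum>s<n. Q $$ (s, s))"
    by (simp add: of_bool_def if_distrib[of "\<lambda>x. _ * x"] cong: if_cong)
  finally show ?thesis .
qed

lemma pow2_congruence_mat:
  assumes "is_orthogonal_mat n U" "Q \<in> carrier_mat n n"
  shows "(U * Q * U\<^sup>T) ^\<^sub>m 2 = U * (Q * Q) * U\<^sup>T"
proof -
  note U = is_orthogonal_matD[OF assms(1)] and Q = assms(2)
  have "(U * Q * U\<^sup>T) ^\<^sub>m 2 = (U * Q * U\<^sup>T) * (U * Q * U\<^sup>T)"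
    using U by (simp add: numeral_2_eq_2)
  also have "\<dots> = U * Q * (U\<^sup>T * (U * (Q * U\<^sup>T)))"
    using U Q by (simp add: assoc_mult_mat[of _ n n _ n _ n])
  also have "U\<^sup>T * (U * (Q * U\<^sup>T)) = Q * U\<^sup>T"
    using U Q by (subst assoc_mult_mat[of _ n n _ n _ n, symmetric]) auto
  also have "U * Q * (Q * U\<^sup>T) = U * (Q * Q) * U\<^sup>T"
    using U Q by (simp add: assoc_mult_mat[of _ n n _ n _ n])
  finally show ?thesis .
qed

text \<open>Columns of \<open>V\<close> have norm 1, so each has a nonzero entry; since a row has at
  most one, these entries lie in different rows. The \<open>n\<close> columns then use up all rows,
  so every other entry vanishes and the remaining ones square to 1.\<close>

lemma signed_permutation_decomposition:
  assumes V: "is_orthogonal_mat n V"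
    and row: "\<And>i j k. i < n \<Longrightarrow> j < n \<Longrightarrow> k < n \<Longrightarrow>
      V $$ (i, j) \<noteq> 0 \<Longrightarrow> V $$ (i, k) \<noteq> 0 \<Longrightarrow> j = k"
  shows "\<exists>P J. is_permutation_mat n P \<and> is_sign_mat n J \<and> V = P * J"
proof -
  note c = is_orthogonal_matD[OF V]
  have col: "\<exists>i<n. V $$ (i, j) \<noteq> 0" if "j < n" for j
  proof (rule ccontr)
    assume "\<not> ?thesis"
    then have "(\<Sum>i<n. V $$ (i, j) * V $$ (i, j)) = 0" by simp
    then show False using orthogonal_columns[OF V that that] by simp
  qed
  then obtain \<rho> where \<rho>: "\<And>j. j < n \<Longrightarrow> \<rho> j < n \<and> V $$ (\<rho> j, j) \<noteq> 0" by metis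
  \<comment> \<open>\<open>permutes\<close> demands the identity outside
    \<open>{..<n}\<close>.\<close>
  define \<pi> where "\<pi> j = (if j < n then \<rho> j else j)" for j
  have "inj_on \<pi> {..<n}"
    by (rule inj_onI) (metis \<pi>_def \<rho> lessThan_iff row)
  moreover have "\<pi> ` {..<n} \<subseteq> {..<n}" using \<rho> by (auto simp: \<pi>_def)
  ultimately have bij: "bij_betw \<pi> {..<n} {..<n}"
    by (simp add: bij_betw_def endo_inj_surj)
  then have perm: "\<pi> permutes {..<n}" by (intro bij_imp_permutes) (auto simp: \<pi>_def)
  \<comment> \<open>Row \<open>i\<close> belongs to some column \<open>k\<close>, whose nonzero
    entry excludes any other in that row.\<close>
  have entry: "V $$ (i, j) = 0" if "i < n" "j < n" "i \<noteq> \<pi> j" for i j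
  proof -
    obtain k where k: "k < n" "i = \<pi> k"
      using bij \<open>i < n\<close> unfolding bij_betw_def by (metis imageE lessThan_iff)
    then have "V $$ (i, k) \<noteq> 0" using \<rho> by (simp add: \<pi>_def)
    then show ?thesis using row[of i j k] k that by auto
  qed
  have sq: "V $$ (\<pi> j, j) * V $$ (\<pi> j, j) = 1" if "j < n" for j
  proof -
    have "(\<Sum>i<n. V $$ (i, j) * V $$ (i, j)) = (\<Sum>i\<in>{\<pi> j}. V $$ (i, j) * V $$ (i, j))"
      using that \<rho> entry by (intro sum.mono_neutral_right) (auto simp: \<pi>_def)
    then show ?thesis using orthogonal_columns[OF V that that] by simp
  qed
  define P :: "real mat" where "P = mat n n (\<lambda>(i, j). if i = \<pi> j then 1 else 0)"
  define J :: "real mat" where "J = mat n n (\<lambda>(i, j). if i = j then V $$ (\<pi> j, j) else 0)"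
  have "V = P * J"
  proof (rule eq_matI)
    fix i j assume "i < dim_row (P * J)" "j < dim_col (P * J)"
    then have ij: "i < n" "j < n" by (auto simp: P_def J_def)
    have "(P * J) $$ (i, j) = (\<Sum>k<n. (if i = \<pi> k then 1 else 0) * (if k = j then V $$ (\<pi> j, j) else 0))"
      using ij by (subst index_mult_mat_sum[of _ n n _ n]) (auto simp: P_def J_def)
    also have "\<dots> = (if i = \<pi> j then V $$ (\<pi> j, j) else 0)"
      using ij by (simp add: if_distrib[of "\<lambda>x. _ * x"] cong: if_cong)
    finally show "V $$ (i, j) = (P * J) $$ (i, j)" using entry ij by auto
  qed (use c in \<open>auto simp: P_def J_def\<close>)
  moreover have "is_permutation_mat n P"
    using perm unfolding is_permutation_mat_def P_def by blast
  moreover have "is_sign_mat n J"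
    using sq unfolding is_sign_mat_def J_def diagonal_mat_def by (auto simp: square_eq_1_iff)
  ultimately show ?thesis by blast
qed

lemma diag_mult_vec_index:
  fixes x :: "real vec"
  assumes "x \<in> carrier_vec n" "j < n"
  shows "(mat n n (\<lambda>(i, j). if i = j then d i else 0) *\<^sub>v x) $ j = d j * x $ j"
proof -
  have "(mat n n (\<lambda>(i, j). if i = j then d i else 0) *\<^sub>v x) $ j =
      (\<Sum>c<n. (if j = c then d j else 0) * x $ c)"
    using assms by (auto simp: scalar_prod_def lessThan_atLeast0 intro!: sum.cong)
  also have "\<dots> = d j * x $ j"
    using assms(2) by (simp add: if_distrib[of "\<lambda>y. y * _"] cong: if_cong)
  finally show ?thesis .
qed

text \<open>In the basis of the columns of \<open>U\<close>, an eigenvector of \<open>B\<close>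
  becomes an eigenvector \<open>x\<close> of the diagonal matrix, so
  \<open>d j * x $ j = k * x $ j\<close> for all \<open>j\<close>. With distinct \<open>d j\<close>,
  at most one coordinate is nonzero. These coordinates form a row of \<open>W\<^sup>T * U\<close>,
  which is the row condition of the decomposition into permutation and signs.\<close>

lemma eigenvectors_of_diagonalized:
  assumes U: "is_orthogonal_mat n U" and W: "is_orthogonal_mat n W"
    and B: "B = U * mat n n (\<lambda>(i, j). if i = j then d i else 0) * U\<^sup>T"
    and d: "inj_on d {..<n}"
    and ev: "columns_eigenvectors B W"
  shows "\<exists>P J. is_permutation_mat n P \<and> is_sign_mat n J \<and> W\<^sup>T * U = P * J"
proof (rule signed_permutation_decomposition)
  let ?V = "W\<^sup>T * U" and ?L = "mat n n (\<lambda>(i, j). if i = j then d i else 0)"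
  show "is_orthogonal_mat n ?V"
    by (intro is_orthogonal_mat_mult is_orthogonal_mat_transpose U W)
  note cU = is_orthogonal_matD[OF U] and cW = is_orthogonal_matD[OF W]
  have eig: "\<exists>k. \<forall>j<n. d j * ?V $$ (i, j) = k * ?V $$ (i, j)" if i: "i < n" for i
  proof -
    obtain k where "eigenvector B (col W i) k"
      using ev cW(1) i unfolding columns_eigenvectors_def by auto
    then have k: "B *\<^sub>v col W i = k \<cdot>\<^sub>v col W i" by (simp add: eigenvector_def)
    let ?x = "U\<^sup>T *\<^sub>v col W i"
    have x: "?x \<in> carrier_vec n" using cU cW i by auto
    have w: "col W i \<in> carrier_vec n" using cW i by auto
    have Lx: "?L *\<^sub>v ?x \<in> carrier_vec n" by (rule mult_mat_vec_carrier[OF mat_carrier x])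
    have "B *\<^sub>v col W i = U *\<^sub>v (?L *\<^sub>v ?x)"
      unfolding B using cU w by (simp add: assoc_mult_mat_vec[of _ n n _ n])
    then have "U\<^sup>T *\<^sub>v (k \<cdot>\<^sub>v col W i) = U\<^sup>T *\<^sub>v (U *\<^sub>v (?L *\<^sub>v ?x))"
      using k by simp
    also have "\<dots> = ?L *\<^sub>v ?x"
      using cU Lx by (subst assoc_mult_mat_vec[of _ n n _ n, symmetric]) simp_all
    finally have eq: "?L *\<^sub>v ?x = k \<cdot>\<^sub>v ?x"
      using cU w by (simp add: mult_mat_vec[of _ n n])
    have xj: "?x $ j = ?V $$ (i, j)" if "j < n" for j
      using that i cU(1) cW(1) by (auto simp: comm_scalar_prod[of _ n])
    have "d j * ?V $$ (i, j) = k * ?V $$ (i, j)" if "j < n" for j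
    proof -
      have "d j * ?x $ j = (?L *\<^sub>v ?x) $ j"
        by (rule diag_mult_vec_index[OF x that, symmetric])
      also have "\<dots> = k * ?x $ j"
        unfolding eq using x that by (metis carrier_vecD index_smult_vec(1))
      finally show ?thesis unfolding xj[OF that] .
    qed
    then show ?thesis by blast
  qed
  fix i j k assume ijk: "i < n" "j < n" "k < n" "?V $$ (i, j) \<noteq> 0" "?V $$ (i, k) \<noteq> 0"
  obtain l where l: "\<And>j. j < n \<Longrightarrow> d j * ?V $$ (i, j) = l * ?V $$ (i, j)"
    using eig[OF ijk(1)] by blast
  have "d j = l" "d k = l" using l[OF ijk(2)] l[OF ijk(3)] ijk(4,5) by (simp_all del: index_mult_mat)
  then show "j = k" using d ijk by (auto dest: inj_onD)
qed

section \<open>Moments of standardized independent families\<close>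

lemma abs_mult_le_sum_squares: "\<bar>x * y\<bar> \<le> x\<^sup>2 + y\<^sup>2" for x y :: real
  using sum_squares_bound[of "\<bar>x\<bar>" "\<bar>y\<bar>"] mult_nonneg_nonneg[of "\<bar>x\<bar>" "\<bar>y\<bar>"]
  by (simp add: abs_mult mult.assoc del: mult_nonneg_nonneg)

text \<open>Moments up to order four are computed for an arbitrary finite index set; multi-indices
  enter only with \<open>standardized_tensor\<close>.\<close>

locale standardized_family = prob_space +
  fixes I :: "'i set" and Z :: "'a \<Rightarrow> 'i \<Rightarrow> real"
  assumes finite_I [simp]: "finite I"
    and indep: "indep_vars (\<lambda>_. borel) (\<lambda>i \<omega>. Z \<omega> i) I"
    and mean: "i \<in> I \<Longrightarrow> expectation (\<lambda>\<omega>. Z \<omega> i) = 0"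
    and var: "i \<in> I \<Longrightarrow> variance (\<lambda>\<omega>. Z \<omega> i) = 1"
    and fourth: "i \<in> I \<Longrightarrow> integrable M (\<lambda>\<omega>. Z \<omega> i ^ 4)"
begin

lemma measurable_component [measurable]: "i \<in> I \<Longrightarrow> (\<lambda>\<omega>. Z \<omega> i) \<in> borel_measurable M"
  using indep unfolding indep_vars_def by auto

lemma integrable_power:
  assumes "i \<in> I" "n \<le> 4"
  shows "integrable M (\<lambda>\<omega>. Z \<omega> i ^ n)"
proof (rule Bochner_Integration.integrable_bound)
  show "integrable M (\<lambda>\<omega>. 1 + Z \<omega> i ^ 4)"
    using fourth assms by simp
  show "(\<lambda>\<omega>. Z \<omega> i ^ n) \<in> borel_measurable M" using assms by measurable
  \<comment> \<open>The constant dominates for \<open>\<bar>x\<bar> < 1\<close>, the fourth power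
    otherwise.\<close>
  have "\<bar>x\<bar> ^ n \<le> 1 + \<bar>x\<bar> ^ 4" for x :: real
    using power_increasing[of n 4 "\<bar>x\<bar>"] power_le_one[of "\<bar>x\<bar>" n] assms(2)
      zero_le_power[of "\<bar>x\<bar>" 4]
    by (cases "1 \<le> \<bar>x\<bar>") (simp_all add: add_increasing2 del: zero_le_power_abs)
  then show "AE \<omega> in M. norm (Z \<omega> i ^ n) \<le> norm (1 + Z \<omega> i ^ 4)"
    by (simp add: power_abs)
qed

lemma expectation_square: "i \<in> I \<Longrightarrow> expectation (\<lambda>\<omega>. (Z \<omega> i)\<^sup>2) = 1"
  using var[of i] mean[of i] by simp

text \<open>Applying \<open>\<bar>x * y\<bar> \<le> x\<^sup>2 + y\<^sup>2\<close> twice bounds the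
  product by a sum of fourth powers, whichever indices coincide.\<close>

lemma integrable_mult4:
  assumes "i \<in> I" "j \<in> I" "k \<in> I" "l \<in> I"
  shows "integrable M (\<lambda>\<omega>. Z \<omega> i * Z \<omega> j * Z \<omega> k * Z \<omega> l)"
proof (rule Bochner_Integration.integrable_bound)
  show "integrable M (\<lambda>\<omega>. Z \<omega> i ^ 4 + Z \<omega> j ^ 4 + Z \<omega> k ^ 4 + Z \<omega> l ^ 4)"
    using fourth assms by simp
  show "(\<lambda>\<omega>. Z \<omega> i * Z \<omega> j * Z \<omega> k * Z \<omega> l) \<in> borel_measurable M"
    using assms by measurable
  have "\<bar>a * b * c * d\<bar> \<le> a ^ 4 + b ^ 4 + c ^ 4 + d ^ 4" for a b c d :: real
  proof -
    note two = abs_mult_le_sum_squares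
    have "\<bar>a * b * (c * d)\<bar> \<le> (a * b)\<^sup>2 + (c * d)\<^sup>2" by (rule two)
    also have "\<dots> \<le> (a ^ 4 + b ^ 4) + (c ^ 4 + d ^ 4)"
      using two[of "a\<^sup>2" "b\<^sup>2"] two[of "c\<^sup>2" "d\<^sup>2"]
      by (intro add_mono) (simp_all add: power_mult_distrib abs_mult)
    finally show ?thesis by (simp add: mult.assoc)
  qed
  then show "AE \<omega> in M. norm (Z \<omega> i * Z \<omega> j * Z \<omega> k * Z \<omega> l) \<le>
      norm (Z \<omega> i ^ 4 + Z \<omega> j ^ 4 + Z \<omega> k ^ 4 + Z \<omega> l ^ 4)"
    unfolding real_norm_def by (intro AE_I2) (metis abs_ge_self order_trans)
qed

lemma expectation_prod_power:
  assumes "J \<subseteq> I" "\<And>n. n \<in> J \<Longrightarrow> e n \<le> 4"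
  shows "expectation (\<lambda>\<omega>. \<Prod>n\<in>J. Z \<omega> n ^ e n) = (\<Prod>n\<in>J. expectation (\<lambda>\<omega>. Z \<omega> n ^ e n))"
proof (rule indep_vars_lebesgue_integral)
  show "finite J" using assms(1) finite_I by (rule finite_subset)
  show "indep_vars (\<lambda>_. borel) (\<lambda>n \<omega>. Z \<omega> n ^ e n) J"
    using indep_vars_subset[OF indep assms(1)] by (rule indep_vars_compose2) measurable
qed (use assms integrable_power in blast)

text \<open>Collecting equal indices turns the monomial into a product of powers of independent
  components, in which \<open>Z \<omega> i\<close> has exponent 1 and contributes its mean 0 as a
  factor.\<close>

lemma expectation_mult4_isolated:
  assumes "i \<in> I" "j \<in> I" "k \<in> I" "l \<in> I" "i \<notin> {j, k, l}"
  shows "expectation (\<lambda>\<omega>. Z \<omega> i * Z \<omega> j * Z \<omega> k * Z \<omega> l) = 0"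
proof -
  \<comment> \<open>\<open>e n\<close> counts how often \<open>n\<close> occurs among the four
    indices.\<close>
  define e :: "'i \<Rightarrow> nat" where
    "e n = of_bool (n = i) + of_bool (n = j) + of_bool (n = k) + of_bool (n = l)" for n
  have "Z \<omega> i * Z \<omega> j * Z \<omega> k * Z \<omega> l = (\<Prod>n\<in>{i, j, k, l}. Z \<omega> n ^ e n)" for \<omega>
    by (simp add: e_def power_add prod.distrib prod.If_cases of_bool_def if_distrib[of "(^) _"]
      prod.delta del: prod.insert cong: if_cong)
  then have "expectation (\<lambda>\<omega>. Z \<omega> i * Z \<omega> j * Z \<omega> k * Z \<omega> l) =
      (\<Prod>n\<in>{i, j, k, l}. expectation (\<lambda>\<omega>. Z \<omega> n ^ e n))"
    using assms by (simp only:) (intro expectation_prod_power; auto simp: e_def)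
  moreover have "e i = 1" using assms(5) by (auto simp: e_def)
  then have "expectation (\<lambda>\<omega>. Z \<omega> i ^ e i) = 0" using mean assms by simp
  ultimately show ?thesis by auto
qed

lemma expectation_mult4_paired:
  assumes "i \<in> I" "j \<in> I"
  shows "expectation (\<lambda>\<omega>. Z \<omega> i * Z \<omega> i * Z \<omega> j * Z \<omega> j) =
    (if i = j then expectation (\<lambda>\<omega>. Z \<omega> i ^ 4) else 1)"
proof (cases "i = j")
  case True
  then show ?thesis by (simp add: numeral_eq_Suc mult.assoc)
next
  case False
  then have "expectation (\<lambda>\<omega>. Z \<omega> i * Z \<omega> i * Z \<omega> j * Z \<omega> j) =
      expectation (\<lambda>\<omega>. \<Prod>n\<in>{i, j}. Z \<omega> n ^ 2)"
    by (simp add: power2_eq_square mult.assoc)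
  also have "\<dots> = 1"
    using False assms by (subst expectation_prod_power) (auto simp: expectation_square)
  finally show ?thesis using False by simp
qed

lemma expectation_mult2:
  assumes "i \<in> I" "j \<in> I"
  shows "expectation (\<lambda>\<omega>. Z \<omega> i * Z \<omega> j) = of_bool (i = j)"
proof (cases "i = j")
  case True
  then show ?thesis using expectation_square assms by (simp add: power2_eq_square)
next
  case False
  then have "expectation (\<lambda>\<omega>. Z \<omega> i * Z \<omega> j) = expectation (\<lambda>\<omega>. \<Prod>n\<in>{i, j}. Z \<omega> n ^ 1)"
    by simp
  also have "\<dots> = 0"
    using False assms by (subst expectation_prod_power) (auto simp: mean)
  finally show ?thesis using False by simp
qed

lemma integrable_mult2:
  assumes "i \<in> I" "j \<in> I"
  shows "integrable M (\<lambda>\<omega>. Z \<omega> i * Z \<omega> j)"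
proof (rule Bochner_Integration.integrable_bound)
  show "integrable M (\<lambda>\<omega>. (Z \<omega> i)\<^sup>2 + (Z \<omega> j)\<^sup>2)"
    using integrable_power[of _ 2] assms by simp
  show "AE \<omega> in M. norm (Z \<omega> i * Z \<omega> j) \<le> norm ((Z \<omega> i)\<^sup>2 + (Z \<omega> j)\<^sup>2)"
    using abs_mult_le_sum_squares by simp
qed (use assms in measurable)

end

section \<open>Mode products under orthogonal transformations\<close>

lemma prod_row_upd:
  fixes f :: "nat \<Rightarrow> nat \<Rightarrow> real"
  assumes "m < r"
  shows "(\<Prod>n<r. f n ((i(m := s)) n)) = f m s * (\<Prod>n\<in>{..<r} - {m}. f n (i n))"
proof -
  have "(\<Prod>n\<in>{..<r} - {m}. f n ((i(m := s)) n)) = (\<Prod>n\<in>{..<r} - {m}. f n (i n))"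
    by (intro prod.cong) auto
  then show ?thesis
    using assms by (subst prod.remove[of _ m]) auto
qed

lemma mode_prod_carrier [simp]: "mode_prod r p m A B \<in> carrier_mat (p m) (p m)"
  by (simp add: mode_prod_def)

lemma index_mode_prod:
  "s < p m \<Longrightarrow> t < p m \<Longrightarrow> mode_prod r p m A B $$ (s, t) =
    (\<Sum>i\<in>tensor_idx ({..<r} - {m}) p. A (i(m := s)) * B (i(m := t)))"
  by (simp add: mode_prod_def)

text \<open>The mode product is quadratic in \<open>A\<close>, and the summed index \<open>i\<close>
  meets only the matrices of the modes other than \<open>m\<close>, where the sum factorises into
  Gram entries. It serves the covariance with \<open>B = \<Omega>\<close> and rotations with
  \<open>B = U\<close>.\<close>

lemma index_mode_prod_tensor_mat_prods:
  assumes m: "m < r" and B: "\<And>n. n < r \<Longrightarrow> B n \<in> carrier_mat (p n) (p n)"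
    and Y: "\<And>i. i \<in> tensor_idx {..<r} p \<Longrightarrow> Y i = tensor_mat_prods r A B i"
    and st: "s < p m" "t < p m"
  shows "mode_prod r p m Y Y $$ (s, t) =
    (\<Sum>k\<in>tensor_idx {..<r} p. \<Sum>l\<in>tensor_idx {..<r} p. A k * A l *
      (B m $$ (s, k m) * B m $$ (t, l m) *
       (\<Prod>n\<in>{..<r} - {m}. \<Sum>c<p n. B n $$ (c, k n) * B n $$ (c, l n))))"
proof -
  let ?I = "tensor_idx {..<r} p" and ?T = "tensor_idx ({..<r} - {m}) p"
  have row: "Y (i(m := u)) = (\<Sum>k\<in>?I. A k * (B m $$ (u, k m) * (\<Prod>n\<in>{..<r} - {m}. B n $$ (i n, k n))))"
    if "i \<in> ?T" "u < p m" for i u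
  proof -
    have "i(m := u) \<in> ?I" using that m by (intro tensor_idx_upd) auto
    then have "Y (i(m := u)) = (\<Sum>k\<in>?I. A k * (\<Prod>n<r. B n $$ ((i(m := u)) n, k n)))"
      using Y tensor_mat_prods_eq[of r B p "i(m := u)" p A] B by (auto simp: carrier_matD)
    then show ?thesis by (simp only: prod_row_upd[OF m, of "\<lambda>n c. B n $$ (c, _ n)"])
  qed
  have "mode_prod r p m Y Y $$ (s, t) = (\<Sum>i\<in>?T. Y (i(m := s)) * Y (i(m := t)))"
    using st by (rule index_mode_prod)
  also have "\<dots> = (\<Sum>i\<in>?T. \<Sum>k\<in>?I. \<Sum>l\<in>?I. A k * A l * (B m $$ (s, k m) * B m $$ (t, l m) *
      (\<Prod>n\<in>{..<r} - {m}. B n $$ (i n, k n) * B n $$ (i n, l n))))"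
  proof (rule sum.cong[OF refl])
    fix i assume i: "i \<in> ?T"
    show "Y (i(m := s)) * Y (i(m := t)) = (\<Sum>k\<in>?I. \<Sum>l\<in>?I. A k * A l *
      (B m $$ (s, k m) * B m $$ (t, l m) *
      (\<Prod>n\<in>{..<r} - {m}. B n $$ (i n, k n) * B n $$ (i n, l n))))"
      unfolding row[OF i st(1)] row[OF i st(2)] sum_product prod.distrib
      by (intro sum.cong refl) (simp only: mult_ac)
  qed
  also have "\<dots> = (\<Sum>k\<in>?I. \<Sum>l\<in>?I. \<Sum>i\<in>?T. A k * A l * (B m $$ (s, k m) * B m $$ (t, l m) *
      (\<Prod>n\<in>{..<r} - {m}. B n $$ (i n, k n) * B n $$ (i n, l n))))"
    by (subst sum.swap, rule sum.cong[OF refl], rule sum.swap)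
  also have "\<dots> = (\<Sum>k\<in>?I. \<Sum>l\<in>?I. A k * A l *
      (B m $$ (s, k m) * B m $$ (t, l m) *
       (\<Prod>n\<in>{..<r} - {m}. \<Sum>c<p n. B n $$ (c, k n) * B n $$ (c, l n))))"
    by (simp add: sum_distrib_left[symmetric]
        sum_tensor_idx_prod[of _ "\<lambda>n c. B n $$ (c, _ n) * B n $$ (c, _ n)"])
  finally show ?thesis .
qed

text \<open>In every mode other than \<open>m\<close> the Gram entries of \<open>U n\<close> are
  Kronecker deltas, so the two multi-indices must agree there; only the rotation in mode
  \<open>m\<close> survives, as a congruence.\<close>

lemma mode_prod_orthogonal:
  assumes m: "m < r" and U: "\<And>n. n < r \<Longrightarrow> is_orthogonal_mat (p n) (U n)"
    and Y: "\<And>i. i \<in> tensor_idx {..<r} p \<Longrightarrow> Y i = tensor_mat_prods r A U i"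
  shows "mode_prod r p m Y Y = U m * mode_prod r p m A A * (U m)\<^sup>T"
proof (rule eq_matI)
  let ?I = "tensor_idx {..<r} p" and ?T = "tensor_idx ({..<r} - {m}) p"
  note Uc = is_orthogonal_matD(1)[OF U]
  show "dim_row (mode_prod r p m Y Y) = dim_row (U m * mode_prod r p m A A * (U m)\<^sup>T)"
    "dim_col (mode_prod r p m Y Y) = dim_col (U m * mode_prod r p m A A * (U m)\<^sup>T)"
    using Uc[OF m] by (auto simp: mode_prod_def)
  fix s t
  assume "s < dim_row (U m * mode_prod r p m A A * (U m)\<^sup>T)"
    "t < dim_col (U m * mode_prod r p m A A * (U m)\<^sup>T)"
  then have st: "s < p m" "t < p m" using Uc[OF m] by auto
  have delta: "(\<Prod>n\<in>{..<r} - {m}. \<Sum>c<p n. U n $$ (c, (i(m := u)) n) * U n $$ (c, (j(m := v)) n)) =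
      of_bool (i = j)" if ij: "i \<in> ?T" "j \<in> ?T" for i j u v
  proof -
    have "(\<Prod>n\<in>{..<r} - {m}. \<Sum>c<p n. U n $$ (c, (i(m := u)) n) * U n $$ (c, (j(m := v)) n)) =
        (\<Prod>n\<in>{..<r} - {m}. of_bool (i n = j n))"
      using ij U by (intro prod.cong refl)
        (auto simp: orthogonal_columns dest!: tensor_idx_less)
    also have "\<dots> = of_bool (i = j)"
    proof (cases "i = j")
      case False
      \<comment> \<open>Both multi-indices are \<open>undefined\<close> outside
        \<open>{..<r} - {m}\<close>, so they differ inside it and one factor is 0.\<close>
      then obtain n where "i n \<noteq> j n" by auto
      moreover from this ij have "n \<in> {..<r} - {m}"
        unfolding tensor_idx_def by (metis PiE_arb)
      ultimately show ?thesis using False by (auto intro!: prod_zero)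
    qed simp
    finally show ?thesis .
  qed
  have "mode_prod r p m Y Y $$ (s, t) = (\<Sum>k\<in>?I. \<Sum>l\<in>?I. A k * A l *
      (U m $$ (s, k m) * U m $$ (t, l m) *
       (\<Prod>n\<in>{..<r} - {m}. \<Sum>c<p n. U n $$ (c, k n) * U n $$ (c, l n))))"
    using m Uc Y st by (rule index_mode_prod_tensor_mat_prods)
  also have "\<dots> = (\<Sum>u<p m. \<Sum>i\<in>?T. \<Sum>v<p m. \<Sum>j\<in>?T. A (i(m := u)) * A (j(m := v)) *
      (U m $$ (s, u) * U m $$ (t, v) * of_bool (i = j)))"
    unfolding sum_tensor_idx_split[OF m]
    by (intro sum.cong refl) (simp only: delta fun_upd_same)
  also have "\<dots> = (\<Sum>u<p m. \<Sum>i\<in>?T. \<Sum>v<p m. A (i(m := u)) * A (i(m := v)) *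
      (U m $$ (s, u) * U m $$ (t, v)))"
    by (intro sum.cong refl)
      (simp add: of_bool_def if_distrib[of "\<lambda>x. _ * x"] cong: if_cong)
  also have "\<dots> = (\<Sum>u<p m. \<Sum>v<p m. U m $$ (s, u) * mode_prod r p m A A $$ (u, v) * U m $$ (t, v))"
    by (rule sum.cong[OF refl], subst sum.swap, rule sum.cong[OF refl])
      (simp add: index_mode_prod sum_distrib_left sum_distrib_right mult_ac)
  also have "\<dots> = (U m * mode_prod r p m A A * (U m)\<^sup>T) $$ (s, t)"
    using Uc[OF m] st by (intro index_congruence_mat[symmetric]) auto
  finally show "mode_prod r p m Y Y $$ (s, t) = (U m * mode_prod r p m A A * (U m)\<^sup>T) $$ (s, t)" .
qed

lemma tensor_frob_squared:
  assumes "m < r"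
  shows "(tensor_frob r p Y)\<^sup>2 = (\<Sum>s<p m. mode_prod r p m Y Y $$ (s, s))"
  using assms
  by (simp add: tensor_frob_def sum_nonneg sum_tensor_idx_split index_mode_prod power2_eq_square)

lemma mat_frob_squared:
  "A \<in> carrier_mat n k \<Longrightarrow> (mat_frob A)\<^sup>2 = (\<Sum>c<n. \<Sum>d<k. (A $$ (c, d))\<^sup>2)"
  by (simp add: mat_frob_def sum_nonneg)

lemma codim_eq_card: "codim r p m = real (card (tensor_idx ({..<r} - {m}) p))"
  by (simp add: codim_def card_tensor_idx)

text \<open>The slice \<open>i m = k\<close> is parametrised by \<open>i(m := k)\<close> with
  \<open>i\<close> ranging over the other modes; applied to \<open>A\<close> and to the constant 1
  this gives the numerator and the cardinality.\<close>

lemma index_mode_mean: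
  assumes "m < r" "k < p m"
  shows "mode_mean r p m A $ k = (\<Sum>i\<in>tensor_idx ({..<r} - {m}) p. A (i(m := k))) / codim r p m"
proof -
  have slice: "(\<Sum>i\<in>{i \<in> tensor_idx {..<r} p. i m = k}. f i) =
      (\<Sum>i\<in>tensor_idx ({..<r} - {m}) p. f (i(m := k)))" for f :: "multi_index \<Rightarrow> real"
  proof -
    have "(\<Sum>i\<in>{i \<in> tensor_idx {..<r} p. i m = k}. f i) =
        (\<Sum>i\<in>tensor_idx {..<r} p. if i m = k then f i else 0)"
      by (subst sum.inter_filter) auto
    also have "\<dots> = (\<Sum>u<p m. if u = k then \<Sum>i\<in>tensor_idx ({..<r} - {m}) p. f (i(m := u)) else 0)"
      unfolding sum_tensor_idx_split[OF assms(1)] by (intro sum.cong) auto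
    finally show ?thesis using assms(2) by simp
  qed
  show ?thesis
    using assms slice[of A] slice[of "\<lambda>_. 1"] by (simp add: mode_mean_def codim_eq_card)
qed

text \<open>For \<open>U = (1 / a) \<cdot>\<^sub>m (G * \<Omega>)\<close>, the product
  \<open>U * U\<^sup>T\<close> is \<open>G * S * G\<^sup>T\<close> with \<open>S\<close> the given
  scaled Gram matrix, hence the identity. The argument covers every inverse square root.\<close>

lemma is_orthogonal_whitening:
  assumes \<Omega>: "\<Omega> \<in> carrier_mat n n" and G: "is_inverse_sqrt n ((1 / a\<^sup>2) \<cdot>\<^sub>m (\<Omega> * \<Omega>\<^sup>T)) G"
  shows "is_orthogonal_mat n ((1 / a) \<cdot>\<^sub>m (G * \<Omega>))"
proof -
  have Gc: "G \<in> carrier_mat n n" and one: "G * ((1 / a\<^sup>2) \<cdot>\<^sub>m (\<Omega> * \<Omega>\<^sup>T)) * G\<^sup>T = 1\<^sub>m n"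
    using G by (auto simp: is_inverse_sqrt_def)
  let ?U = "(1 / a) \<cdot>\<^sub>m (G * \<Omega>)"
  have Uc: "?U \<in> carrier_mat n n" using Gc \<Omega> by auto
  have "?U * ?U\<^sup>T = (1 / a\<^sup>2) \<cdot>\<^sub>m (G * \<Omega> * (\<Omega>\<^sup>T * G\<^sup>T))"
  proof -
    have "?U\<^sup>T = (1 / a) \<cdot>\<^sub>m (\<Omega>\<^sup>T * G\<^sup>T)"
      unfolding transpose_mult[OF Gc \<Omega>, symmetric] by (rule eq_matI) auto
    moreover have "?U * ((1 / a) \<cdot>\<^sub>m (\<Omega>\<^sup>T * G\<^sup>T)) = (1 / a) \<cdot>\<^sub>m ((1 / a) \<cdot>\<^sub>m (G * \<Omega> * (\<Omega>\<^sup>T * G\<^sup>T)))"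
      using Gc \<Omega> by (simp add: mult_smult_distrib[of _ n n _ n] mult_smult_assoc_mat[of _ n n _ n])
    moreover have "(1 / a) \<cdot>\<^sub>m ((1 / a) \<cdot>\<^sub>m A) = (1 / a\<^sup>2) \<cdot>\<^sub>m A" for A
      by (rule eq_matI) (auto simp: power2_eq_square)
    ultimately show ?thesis by simp
  qed
  also have "G * \<Omega> * (\<Omega>\<^sup>T * G\<^sup>T) = G * (\<Omega> * \<Omega>\<^sup>T) * G\<^sup>T"
    using Gc \<Omega> by (simp add: assoc_mult_mat[of _ n n _ n _ n])
  also have "(1 / a\<^sup>2) \<cdot>\<^sub>m (G * (\<Omega> * \<Omega>\<^sup>T) * G\<^sup>T) = G * ((1 / a\<^sup>2) \<cdot>\<^sub>m (\<Omega> * \<Omega>\<^sup>T)) * G\<^sup>T"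
    using Gc \<Omega> by (simp add: mult_smult_distrib[of _ n n _ n] mult_smult_assoc_mat[of _ n n _ n])
  finally have "?U * ?U\<^sup>T = 1\<^sub>m n" using one by simp
  then have "is_orthogonal_mat n ?U\<^sup>T"
    using Uc unfolding is_orthogonal_mat_def by simp
  then show ?thesis using is_orthogonal_mat_transpose[of n "?U\<^sup>T"] by simp
qed

text \<open>Congruence with the constant matrix \<open>U\<close> is linear and so commutes with the
  entrywise expectation. \<open>R\<close> is the random matrix before rotation; both
  \<open>mode_B0\<close> and \<open>mode_B1\<close> are brought into this form.\<close>

lemma smult_mat_expectation_congruence:
  assumes U: "U \<in> carrier_mat n n" and R: "\<And>\<omega>. R \<omega> \<in> carrier_mat n n"
    and Y: "\<And>\<omega>. \<omega> \<in> space M \<Longrightarrow> Y \<omega> = U * R \<omega> * U\<^sup>T"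
    and int: "\<And>u v. u < n \<Longrightarrow> v < n \<Longrightarrow> integrable M (\<lambda>\<omega>. R \<omega> $$ (u, v))"
    and E: "\<And>u v. u < n \<Longrightarrow> v < n \<Longrightarrow> a * (\<integral>\<omega>. R \<omega> $$ (u, v) \<partial>M) = (if u = v then d u else 0)"
  shows "a \<cdot>\<^sub>m mat_expectation M n Y = U * mat n n (\<lambda>(i, j). if i = j then d i else 0) * U\<^sup>T"
proof (rule eq_matI)
  let ?L = "mat n n (\<lambda>(i, j). if i = j then d i else 0)"
  fix s t assume "s < dim_row (U * ?L * U\<^sup>T)" "t < dim_col (U * ?L * U\<^sup>T)"
  then have st: "s < n" "t < n" using U by auto
  have "(\<integral>\<omega>. Y \<omega> $$ (s, t) \<partial>M) =
      (\<integral>\<omega>. (\<Sum>u<n. \<Sum>v<n. U $$ (s, u) * R \<omega> $$ (u, v) * U $$ (t, v)) \<partial>M)"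
    using U R st Y by (intro Bochner_Integration.integral_cong refl)
      (simp add: index_congruence_mat del: index_mult_mat)
  also have "\<dots> = (\<Sum>u<n. \<Sum>v<n. U $$ (s, u) * (\<integral>\<omega>. R \<omega> $$ (u, v) \<partial>M) * U $$ (t, v))"
  proof -
    have "integrable M (\<lambda>\<omega>. U $$ (s, u) * R \<omega> $$ (u, v) * U $$ (t, v))"
      if "u < n" "v < n" for u v
      using int[OF that] by simp
    then have "(\<integral>\<omega>. (\<Sum>u<n. \<Sum>v<n. U $$ (s, u) * R \<omega> $$ (u, v) * U $$ (t, v)) \<partial>M) =
        (\<Sum>u<n. \<Sum>v<n. (\<integral>\<omega>. U $$ (s, u) * R \<omega> $$ (u, v) * U $$ (t, v) \<partial>M))"
      by (subst Bochner_Integration.integral_sum)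
        (auto intro!: sum.cong Bochner_Integration.integral_sum)
    then show ?thesis by simp
  qed
  finally have "a * (\<integral>\<omega>. Y \<omega> $$ (s, t) \<partial>M) =
      (\<Sum>u<n. \<Sum>v<n. U $$ (s, u) * (a * (\<integral>\<omega>. R \<omega> $$ (u, v) \<partial>M)) * U $$ (t, v))"
    by (simp add: sum_distrib_left mult_ac)
  also have "\<dots> = (\<Sum>u<n. \<Sum>v<n. U $$ (s, u) * ?L $$ (u, v) * U $$ (t, v))"
    by (intro sum.cong refl) (simp add: E)
  also have "\<dots> = (U * ?L * U\<^sup>T) $$ (s, t)"
    using U st by (intro index_congruence_mat[symmetric]) auto
  finally show "(a \<cdot>\<^sub>m mat_expectation M n Y) $$ (s, t) = (U * ?L * U\<^sup>T) $$ (s, t)"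
    using st by (simp add: mat_expectation_def del: index_mult_mat)
qed (use U in \<open>auto simp: mat_expectation_def\<close>)

section \<open>Second and fourth moments of mode products\<close>

text \<open>Both multi-indices are \<open>undefined\<close> at \<open>m\<close>, so overwriting that
  place loses nothing. In the moment computations this decides which components of \<open>Z\<close>
  coincide.\<close>

lemma tensor_idx_upd_eq_iff:
  assumes "a \<in> tensor_idx (I - {m}) p" "b \<in> tensor_idx (I - {m}) p"
  shows "a(m := u) = b(m := v) \<longleftrightarrow> a = b \<and> u = v"
proof
  assume eq: "a(m := u) = b(m := v)"
  have "a n = b n" for n
  proof (cases "n = m")
    case True
    then show ?thesis using assms unfolding tensor_idx_def by (auto simp: PiE_iff extensional_def)
  next
    case False
    then show ?thesis using fun_cong[OF eq, of n] by simp
  qed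
  then show "a = b \<and> u = v" using fun_cong[OF eq, of m] by auto
qed simp

lemma mode_prod_smult:
  "mode_prod r p m (\<lambda>k. c * A k) (\<lambda>k. c * A k) = c\<^sup>2 \<cdot>\<^sub>m mode_prod r p m A A"
  by (rule eq_matI) (auto simp: mode_prod_def sum_distrib_left power2_eq_square mult_ac)

lemma tensor_mat_prods_cong:
  assumes "\<And>m. m < r \<Longrightarrow> B m = C m"
  shows "tensor_mat_prods r A B = tensor_mat_prods r A C"
  using assms by (induction r) auto

locale standardized_tensor = standardized_family M "tensor_idx {..<r} p" Z
  for M :: "'a measure" and r :: nat and p :: "nat \<Rightarrow> nat" and Z :: "'a \<Rightarrow> tensor"
begin

text \<open>For \<open>m < r\<close> and \<open>u < p m\<close> this is \<open>codim r p m\<close>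
  times the mode mean of the fourth moments; the moments are raw, without the subtraction of
  3.\<close>

definition slice_kurtosis :: "nat \<Rightarrow> nat \<Rightarrow> real" where
  "slice_kurtosis m u = (\<Sum>i\<in>tensor_idx ({..<r} - {m}) p. expectation (\<lambda>\<omega>. Z \<omega> (i(m := u)) ^ 4))"

text \<open>The components of \<open>Z\<close> are uncorrelated with second moment 1, so only the
  terms with \<open>k = l\<close> remain. Mode \<open>m\<close> then yields
  \<open>\<Omega> m * (\<Omega> m)\<^sup>T\<close>, and each other mode the sum of its squared
  column norms.\<close>

lemma mode_cov_tensor_mat_prods:
  assumes m: "m < r" and \<Omega>: "\<And>n. n < r \<Longrightarrow> \<Omega> n \<in> carrier_mat (p n) (p n)"
    and X: "\<And>\<omega> i. \<omega> \<in> space M \<Longrightarrow> i \<in> tensor_idx {..<r} p \<Longrightarrow>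
      X \<omega> i = tensor_mat_prods r (Z \<omega>) \<Omega> i"
  shows "mode_cov M r p m X =
    ((\<Prod>n\<in>{..<r} - {m}. (mat_frob (\<Omega> n))\<^sup>2) / codim r p m) \<cdot>\<^sub>m (\<Omega> m * (\<Omega> m)\<^sup>T)"
proof (rule eq_matI)
  let ?I = "tensor_idx {..<r} p" and ?T = "tensor_idx ({..<r} - {m}) p"
  let ?c = "\<Prod>n\<in>{..<r} - {m}. (mat_frob (\<Omega> n))\<^sup>2"
  fix s t
  assume "s < dim_row ((?c / codim r p m) \<cdot>\<^sub>m (\<Omega> m * (\<Omega> m)\<^sup>T))"
    "t < dim_col ((?c / codim r p m) \<cdot>\<^sub>m (\<Omega> m * (\<Omega> m)\<^sup>T))"
  then have st: "s < p m" "t < p m" using \<Omega>[OF m] by auto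
  define w where "w k l = \<Omega> m $$ (s, k m) * \<Omega> m $$ (t, l m) *
    (\<Prod>n\<in>{..<r} - {m}. \<Sum>c<p n. \<Omega> n $$ (c, k n) * \<Omega> n $$ (c, l n))" for k l :: multi_index
  have gram: "(\<Omega> m * (\<Omega> m)\<^sup>T) $$ (s, t) = (\<Sum>u<p m. \<Omega> m $$ (s, u) * \<Omega> m $$ (t, u))"
    using \<Omega>[OF m] st by (subst index_mult_mat_sum[of _ "p m" "p m" _ "p m"]) auto
  have "expectation (\<lambda>\<omega>. mode_prod r p m (X \<omega>) (X \<omega>) $$ (s, t)) =
      expectation (\<lambda>\<omega>. \<Sum>k\<in>?I. \<Sum>l\<in>?I. Z \<omega> k * Z \<omega> l * w k l)"
    unfolding w_def
    by (intro Bochner_Integration.integral_cong refl index_mode_prod_tensor_mat_prods m \<Omega> X st)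
  also have "\<dots> = (\<Sum>k\<in>?I. \<Sum>l\<in>?I. expectation (\<lambda>\<omega>. Z \<omega> k * Z \<omega> l * w k l))"
    using integrable_mult2 by (subst Bochner_Integration.integral_sum)
      (auto intro!: sum.cong Bochner_Integration.integral_sum)
  also have "\<dots> = (\<Sum>k\<in>?I. \<Sum>l\<in>?I. of_bool (k = l) * w k l)"
    by (intro sum.cong refl) (simp add: expectation_mult2)
  also have "\<dots> = (\<Sum>k\<in>?I. w k k)"
    by (simp add: of_bool_def if_distrib[of "\<lambda>x. x * _"] cong: if_cong)
  also have "\<dots> = (\<Sum>u<p m. \<Sum>i\<in>?T. \<Omega> m $$ (s, u) * \<Omega> m $$ (t, u) *
      (\<Prod>n\<in>{..<r} - {m}. \<Sum>c<p n. (\<Omega> n $$ (c, i n))\<^sup>2))"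
    unfolding sum_tensor_idx_split[OF m] w_def
    by (intro sum.cong refl arg_cong2[where f = "(*)"] prod.cong) (auto simp: power2_eq_square)
  also have "\<dots> = (\<Omega> m * (\<Omega> m)\<^sup>T) $$ (s, t) * (\<Prod>n\<in>{..<r} - {m}. \<Sum>d<p n. \<Sum>c<p n. (\<Omega> n $$ (c, d))\<^sup>2)"
    unfolding gram sum_distrib_left[symmetric] sum_distrib_right[symmetric]
    by (subst sum_tensor_idx_prod[of _ "\<lambda>n d. \<Sum>c<p n. (\<Omega> n $$ (c, d))\<^sup>2"]) auto
  also have "(\<Prod>n\<in>{..<r} - {m}. \<Sum>d<p n. \<Sum>c<p n. (\<Omega> n $$ (c, d))\<^sup>2) = ?c"
    by (intro prod.cong refl, subst sum.swap) (simp add: mat_frob_squared[OF \<Omega>])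
  finally show "mode_cov M r p m X $$ (s, t) = ((?c / codim r p m) \<cdot>\<^sub>m (\<Omega> m * (\<Omega> m)\<^sup>T)) $$ (s, t)"
    using st \<Omega>[OF m] by (simp add: mode_cov_def mat_expectation_def)
qed (use \<Omega>[OF m] in \<open>auto simp: mode_cov_def mat_expectation_def\<close>)

text \<open>With \<open>z(a,u)\<close> for \<open>Z \<omega> (a(m := u))\<close>, the entry is the
  sum over \<open>c\<close>, \<open>a\<close>, \<open>b\<close> of
  \<open>z(a,u) z(a,c) z(b,c) z(b,v)\<close>. For \<open>u \<noteq> v\<close> every monomial has a
  component that occurs exactly once. For \<open>u = v\<close> the terms with \<open>c = u\<close>
  give \<open>slice_kurtosis m u + N * (N - 1)\<close>, and each of the \<open>p m - 1\<close> other
  values of \<open>c\<close> gives \<open>N\<close>, from \<open>a = b\<close>.\<close>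

lemma has_expectation_gram_square:
  assumes m: "m < r" and uv: "u < p m" "v < p m"
  defines "N \<equiv> real (card (tensor_idx ({..<r} - {m}) p))"
  defines "Q \<equiv> \<lambda>\<omega>. mode_prod r p m (Z \<omega>) (Z \<omega>)"
  shows "has_bochner_integral M (\<lambda>\<omega>. (Q \<omega> * Q \<omega>) $$ (u, v))
    (if u = v then slice_kurtosis m u + N * (N + real (p m) - 2) else 0)"
proof -
  let ?I = "tensor_idx {..<r} p" and ?T = "tensor_idx ({..<r} - {m}) p"
  let ?\<beta> = "\<lambda>a. expectation (\<lambda>\<omega>. Z \<omega> (a(m := u)) ^ 4)"
  \<comment> \<open>\<open>e c a b\<close> is the expectation of the monomial belonging to
    \<open>c\<close>, \<open>a\<close>, \<open>b\<close>, as verified case by case below.\<close>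
  define e where "e c a b = (if u \<noteq> v then 0 else if c = u then if a = b then ?\<beta> a else 1
    else of_bool (a = b))" for c and a b :: multi_index
  have I: "a(m := c) \<in> ?I" if "a \<in> ?T" "c < p m" for a c
    using that m by (intro tensor_idx_upd) auto
  have entry: "(Q \<omega> * Q \<omega>) $$ (u, v) = (\<Sum>c<p m. \<Sum>a\<in>?T. \<Sum>b\<in>?T.
      Z \<omega> (a(m := u)) * Z \<omega> (a(m := c)) * Z \<omega> (b(m := c)) * Z \<omega> (b(m := v)))" for \<omega>
    using uv by (simp add: Q_def index_mult_mat_sum[of _ "p m" "p m" _ "p m"] index_mode_prod
        sum_product mult.assoc del: index_mult_mat)
  have "expectation (\<lambda>\<omega>. Z \<omega> (a(m := u)) * Z \<omega> (a(m := c)) * Z \<omega> (b(m := c)) * Z \<omega> (b(m := v))) = e c a b"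
    if c: "c < p m" and ab: "a \<in> ?T" "b \<in> ?T" for c a b
  proof -
    note II = I[OF ab(1) uv(1)] I[OF ab(1) c] I[OF ab(2) c] I[OF ab(2) uv(2)]
    note iff = tensor_idx_upd_eq_iff[OF ab] tensor_idx_upd_eq_iff[OF ab(1) ab(1)]
      tensor_idx_upd_eq_iff[OF ab(2) ab(1)] tensor_idx_upd_eq_iff[OF ab(2) ab(2)]
    \<comment> \<open>The first factor differs from the two with \<open>m\<close>th index
      \<open>c\<close>, and from the last one unless \<open>u = v\<close> and
      \<open>a = b\<close>.\<close>
    have isolated_u: ?thesis if "c \<noteq> u" "u \<noteq> v \<or> a \<noteq> b"
      using that expectation_mult4_isolated[OF II] by (auto simp: iff e_def)
    \<comment> \<open>All factors but the last now have \<open>m\<close>th index \<open>u\<close>,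
      so the last one is alone; it is moved to the front.\<close>
    have isolated_v: ?thesis if "c = u" "u \<noteq> v"
    proof -
      have "expectation (\<lambda>\<omega>. Z \<omega> (b(m := v)) * Z \<omega> (a(m := u)) * Z \<omega> (a(m := c)) * Z \<omega> (b(m := c))) = 0"
        using that by (intro expectation_mult4_isolated II) (auto simp: iff)
      then show ?thesis using that by (simp add: e_def mult_ac)
    qed
    have paired1: ?thesis if "c = u" "u = v"
      using that expectation_mult4_paired[OF II(1) I[OF ab(2) uv(1)]] by (auto simp: iff e_def)
    have paired2: ?thesis if "c \<noteq> u" "u = v" "a = b"
      using that expectation_mult4_paired[OF II(1,2)] by (auto simp: iff e_def mult_ac)
    show ?thesis using isolated_u isolated_v paired1 paired2 by blast
  qed
  then have "has_bochner_integral M (\<lambda>\<omega>. (Q \<omega> * Q \<omega>) $$ (u, v)) (\<Sum>c<p m. \<Sum>a\<in>?T. \<Sum>b\<in>?T. e c a b)"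
    unfolding entry
    by (intro has_bochner_integral_sum) (auto simp: has_bochner_integral_iff intro!: integrable_mult4 I uv)
  moreover have "(\<Sum>c<p m. \<Sum>a\<in>?T. \<Sum>b\<in>?T. e c a b) =
      (if u = v then slice_kurtosis m u + N * (N + real (p m) - 2) else 0)"
  proof (cases "u = v")
    case True
    \<comment> \<open>The value \<open>N\<close> of a generic \<open>c\<close> is split off, so that
      the sum over \<open>c\<close> leaves a single correction at \<open>c = u\<close>.\<close>
    have "(\<Sum>a\<in>?T. \<Sum>b\<in>?T. e c a b) = N + (if c = u then slice_kurtosis m u + N * (N - 2) else 0)" for c
    proof (cases "c = u")
      case cu: True
      have "(\<Sum>b\<in>?T. e c a b) = N + (?\<beta> a - 1)" if "a \<in> ?T" for a
      proof -
        have "(\<Sum>b\<in>?T. e c a b) = (\<Sum>b\<in>?T. 1 + (if a = b then ?\<beta> a - 1 else 0))"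
          using True cu by (intro sum.cong) (auto simp: e_def)
        then show ?thesis using that by (simp add: sum.distrib N_def)
      qed
      then have "(\<Sum>a\<in>?T. \<Sum>b\<in>?T. e c a b) = (\<Sum>a\<in>?T. N + (?\<beta> a - 1))"
        by (intro sum.cong) auto
      then show ?thesis
        using cu by (simp add: sum.distrib sum_subtractf slice_kurtosis_def N_def algebra_simps)
    next
      case False
      then show ?thesis using True by (simp add: e_def N_def of_bool_def)
    qed
    then show ?thesis using True uv by (simp add: sum.distrib algebra_simps)
  qed (simp add: e_def)
  ultimately show ?thesis by simp
qed

text \<open>Each monomial is the square of some \<open>z(b,c)\<close> times
  \<open>z(a,u) z(a,v)\<close>, where \<open>z(a,u)\<close> stands for
  \<open>Z \<omega> (a(m := u))\<close>. If \<open>u \<noteq> v\<close>, one of the last two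
  components differs from \<open>z(b,c)\<close> and so occurs once. If \<open>u = v\<close>, all
  \<open>N * N * p m\<close> expectations are 1, except for the \<open>N\<close> fourth moments at
  \<open>c = u\<close>, \<open>b = a\<close>.\<close>

lemma has_expectation_trace_gram:
  assumes m: "m < r" and uv: "u < p m" "v < p m"
  defines "N \<equiv> real (card (tensor_idx ({..<r} - {m}) p))"
  defines "Q \<equiv> \<lambda>\<omega>. mode_prod r p m (Z \<omega>) (Z \<omega>)"
  shows "has_bochner_integral M (\<lambda>\<omega>. (\<Sum>s<p m. Q \<omega> $$ (s, s)) * Q \<omega> $$ (u, v))
    (if u = v then slice_kurtosis m u + N * (N * real (p m) - 1) else 0)"
proof -
  let ?I = "tensor_idx {..<r} p" and ?T = "tensor_idx ({..<r} - {m}) p"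
  let ?\<beta> = "\<lambda>a. expectation (\<lambda>\<omega>. Z \<omega> (a(m := u)) ^ 4)"
  define e where "e c b a = (if u \<noteq> v then 0 else if c = u \<and> b = a then ?\<beta> a else 1)"
    for c and b a :: multi_index
  have I: "a(m := c) \<in> ?I" if "a \<in> ?T" "c < p m" for a c
    using that m by (intro tensor_idx_upd) auto
  have entry: "(\<Sum>s<p m. Q \<omega> $$ (s, s)) * Q \<omega> $$ (u, v) = (\<Sum>c<p m. \<Sum>b\<in>?T. \<Sum>a\<in>?T.
      Z \<omega> (b(m := c)) * Z \<omega> (b(m := c)) * Z \<omega> (a(m := u)) * Z \<omega> (a(m := v)))" for \<omega>
    using uv unfolding sum_distrib_right[of _ "{..<p m}"]
    by (intro sum.cong refl) (simp add: Q_def index_mode_prod sum_product mult.assoc)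
  have "expectation (\<lambda>\<omega>. Z \<omega> (b(m := c)) * Z \<omega> (b(m := c)) * Z \<omega> (a(m := u)) * Z \<omega> (a(m := v))) = e c b a"
    if c: "c < p m" and ab: "a \<in> ?T" "b \<in> ?T" for c a b
  proof -
    note II = I[OF ab(1) uv(1)] I[OF ab(1) uv(2)] I[OF ab(2) c]
    note iff = tensor_idx_upd_eq_iff[OF ab] tensor_idx_upd_eq_iff[OF ab(1) ab(1)]
      tensor_idx_upd_eq_iff[OF ab(2) ab(1)] tensor_idx_upd_eq_iff[OF ab(2) ab(2)]
    have isolated_u: ?thesis if "u \<noteq> v" "\<not> (c = u \<and> b = a)"
    proof -
      have "expectation (\<lambda>\<omega>. Z \<omega> (a(m := u)) * Z \<omega> (a(m := v)) * Z \<omega> (b(m := c)) * Z \<omega> (b(m := c))) = 0"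
        using that by (intro expectation_mult4_isolated II) (auto simp: iff)
      then show ?thesis using that by (simp add: e_def mult_ac)
    qed
    \<comment> \<open>The square is now that of \<open>z(a,u)\<close>, which thus occurs three times
      and leaves \<open>z(a,v)\<close> alone.\<close>
    have isolated_v: ?thesis if "u \<noteq> v" "c = u \<and> b = a"
    proof -
      have "expectation (\<lambda>\<omega>. Z \<omega> (a(m := v)) * Z \<omega> (b(m := c)) * Z \<omega> (b(m := c)) * Z \<omega> (a(m := u))) = 0"
        using that by (intro expectation_mult4_isolated II) (auto simp: iff)
      then show ?thesis using that by (simp add: e_def mult_ac)
    qed
    have paired: ?thesis if "u = v"
      using that expectation_mult4_paired[OF II(3,1)] by (auto simp: iff e_def)
    show ?thesis using isolated_u isolated_v paired by blast
  qed
  then have "has_bochner_integral M (\<lambda>\<omega>. (\<Sum>s<p m. Q \<omega> $$ (s, s)) * Q \<omega> $$ (u, v))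
      (\<Sum>c<p m. \<Sum>b\<in>?T. \<Sum>a\<in>?T. e c b a)"
    unfolding entry
    by (intro has_bochner_integral_sum) (auto simp: has_bochner_integral_iff intro!: integrable_mult4 I uv)
  moreover have "(\<Sum>c<p m. \<Sum>b\<in>?T. \<Sum>a\<in>?T. e c b a) =
      (if u = v then slice_kurtosis m u + N * (N * real (p m) - 1) else 0)"
  proof (cases "u = v")
    case True
    have "(\<Sum>b\<in>?T. \<Sum>a\<in>?T. e c b a) = N * N + (if c = u then slice_kurtosis m u - N else 0)" for c
    proof (cases "c = u")
      case cu: True
      have "(\<Sum>a\<in>?T. e c b a) = N + (?\<beta> b - 1)" if "b \<in> ?T" for b
      proof -
        have "(\<Sum>a\<in>?T. e c b a) = (\<Sum>a\<in>?T. 1 + (if a = b then ?\<beta> b - 1 else 0))"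
          using True cu by (intro sum.cong) (auto simp: e_def)
        then show ?thesis using that by (simp add: sum.distrib N_def)
      qed
      then have "(\<Sum>b\<in>?T. \<Sum>a\<in>?T. e c b a) = (\<Sum>b\<in>?T. N + (?\<beta> b - 1))"
        by (intro sum.cong) auto
      then show ?thesis
        using cu by (simp add: sum.distrib sum_subtractf slice_kurtosis_def N_def algebra_simps)
    next
      case False
      then show ?thesis using True by (simp add: e_def N_def)
    qed
    then show ?thesis using True uv by (simp add: sum.distrib algebra_simps)
  qed (simp add: e_def)
  ultimately show ?thesis by simp
qed

section \<open>Fourth-moment matrices of a rotated tensor\<close>

context
  fixes m :: nat and U :: "nat \<Rightarrow> real mat" and Y :: "'a \<Rightarrow> tensor" and \<tau> :: real
  assumes m: "m < r" and U: "\<And>n. n < r \<Longrightarrow> is_orthogonal_mat (p n) (U n)"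
    and Y: "\<And>\<omega> i. \<omega> \<in> space M \<Longrightarrow> i \<in> tensor_idx {..<r} p \<Longrightarrow>
      Y \<omega> i = tensor_mat_prods r (\<lambda>k. \<tau> * Z \<omega> k) U i"
begin

lemma mode_prod_rotated:
  "\<omega> \<in> space M \<Longrightarrow> mode_prod r p m (Y \<omega>) (Y \<omega>) =
    U m * (\<tau>\<^sup>2 \<cdot>\<^sub>m mode_prod r p m (Z \<omega>) (Z \<omega>)) * (U m)\<^sup>T"
  using mode_prod_orthogonal[OF m U Y] by (simp add: mode_prod_smult)

text \<open>Squaring commutes with the orthogonal congruence, which reduces the claim to the squared
  mode product of \<open>Z\<close>. The shift \<open>K\<close> is the same for all \<open>i\<close>,
  so the diagonal entries separate whenever \<open>slice_kurtosis\<close> does and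
  \<open>\<tau>\<close> is nonzero.\<close>

lemma mode_B0_diagonalized:
  "\<exists>K. mode_B0 M r p m Y = U m * mat (p m) (p m) (\<lambda>(i, j). if i = j
    then \<tau> ^ 4 / codim r p m * (slice_kurtosis m i + K) else 0) * (U m)\<^sup>T"
\<comment> \<open>The witness stays open until the last goal, which fixes it as
  \<open>?N * (?N + real (p m) - 2)\<close>.\<close>
proof (rule exI, unfold mode_B0_def, rule smult_mat_expectation_congruence)
  let ?N = "real (card (tensor_idx ({..<r} - {m}) p))"
  let ?Q = "\<lambda>\<omega>. mode_prod r p m (Z \<omega>) (Z \<omega>)"
  let ?R = "\<lambda>\<omega>. (\<tau>\<^sup>2 \<cdot>\<^sub>m ?Q \<omega>) * (\<tau>\<^sup>2 \<cdot>\<^sub>m ?Q \<omega>)"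
  show "U m \<in> carrier_mat (p m) (p m)" using U[OF m] by (rule is_orthogonal_matD)
  show "?R \<omega> \<in> carrier_mat (p m) (p m)" for \<omega>
    by (intro mult_carrier_mat[of _ _ "p m"] smult_carrier_mat) auto
  show "mode_prod r p m (Y \<omega>) (Y \<omega>) ^\<^sub>m 2 = U m * ?R \<omega> * (U m)\<^sup>T" if "\<omega> \<in> space M" for \<omega>
    unfolding mode_prod_rotated[OF that] by (rule pow2_congruence_mat[OF U[OF m]]) simp
  fix u v assume uv: "u < p m" "v < p m"
  have R: "?R \<omega> $$ (u, v) = \<tau> ^ 4 * (?Q \<omega> * ?Q \<omega>) $$ (u, v)" for \<omega>
    using uv by (simp add: index_mult_mat_sum[of _ "p m" "p m" _ "p m"] mode_prod_def
        sum_distrib_left power4_eq_xxxx power2_eq_square mult_ac del: index_mult_mat)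
  note E = has_expectation_gram_square[OF m uv]
  show "integrable M (\<lambda>\<omega>. ?R \<omega> $$ (u, v))"
    unfolding R using E by (simp add: has_bochner_integral_iff del: index_mult_mat)
  show "1 / codim r p m * (\<integral>\<omega>. ?R \<omega> $$ (u, v) \<partial>M) = (if u = v
      then \<tau> ^ 4 / codim r p m * (slice_kurtosis m u + ?N * (?N + real (p m) - 2)) else 0)"
    unfolding R using E by (simp add: has_bochner_integral_iff del: index_mult_mat)
qed

text \<open>The squared norm is the trace of the mode product, which rotation preserves; it becomes
  a random scalar computed from \<open>\<tau> * Z\<close> and moves inside the congruence.\<close>

lemma mode_B1_diagonalized:
  "\<exists>K. mode_B1 M r p m Y = U m * mat (p m) (p m) (\<lambda>(i, j). if i = j
    then \<tau> ^ 4 / codim r p m * (slice_kurtosis m i + K) else 0) * (U m)\<^sup>T"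
\<comment> \<open>Here the last goal fixes the witness as
  \<open>?N * (?N * real (p m) - 1)\<close>.\<close>
proof (rule exI, unfold mode_B1_def, rule smult_mat_expectation_congruence)
  let ?N = "real (card (tensor_idx ({..<r} - {m}) p))"
  let ?Q = "\<lambda>\<omega>. mode_prod r p m (Z \<omega>) (Z \<omega>)"
  let ?tr = "\<lambda>\<omega>. \<Sum>s<p m. (\<tau>\<^sup>2 \<cdot>\<^sub>m ?Q \<omega>) $$ (s, s)"
  let ?R = "\<lambda>\<omega>. ?tr \<omega> \<cdot>\<^sub>m (\<tau>\<^sup>2 \<cdot>\<^sub>m ?Q \<omega>)"
  note Um = is_orthogonal_matD(1)[OF U[OF m]]
  show "U m \<in> carrier_mat (p m) (p m)" by (rule Um)
  show "?R \<omega> \<in> carrier_mat (p m) (p m)" for \<omega>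
    by (intro smult_carrier_mat) auto
  show "(tensor_frob r p (Y \<omega>))\<^sup>2 \<cdot>\<^sub>m mode_prod r p m (Y \<omega>) (Y \<omega>) = U m * ?R \<omega> * (U m)\<^sup>T"
    if "\<omega> \<in> space M" for \<omega>
  proof -
    have Q: "\<tau>\<^sup>2 \<cdot>\<^sub>m ?Q \<omega> \<in> carrier_mat (p m) (p m)" by simp
    have "(tensor_frob r p (Y \<omega>))\<^sup>2 = ?tr \<omega>"
      unfolding tensor_frob_squared[OF m] mode_prod_rotated[OF that]
      using U[OF m] Q by (rule sum_congruence_diag)
    moreover have "c \<cdot>\<^sub>m (U m * (\<tau>\<^sup>2 \<cdot>\<^sub>m ?Q \<omega>) * (U m)\<^sup>T) =
        U m * (c \<cdot>\<^sub>m (\<tau>\<^sup>2 \<cdot>\<^sub>m ?Q \<omega>)) * (U m)\<^sup>T" for c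
      using mult_smult_distrib[OF Um Q, of c]
        mult_smult_assoc_mat[OF mult_carrier_mat[OF Um Q], of "(U m)\<^sup>T" "p m" c] Um by simp
    ultimately show ?thesis unfolding mode_prod_rotated[OF that] by simp
  qed
  fix u v assume uv: "u < p m" "v < p m"
  have R: "?R \<omega> $$ (u, v) = \<tau> ^ 4 * ((\<Sum>s<p m. ?Q \<omega> $$ (s, s)) * ?Q \<omega> $$ (u, v))" for \<omega>
    using uv by (simp add: mode_prod_def sum_distrib_left[symmetric] power4_eq_xxxx
        power2_eq_square)
  note E = has_expectation_trace_gram[OF m uv]
  show "integrable M (\<lambda>\<omega>. ?R \<omega> $$ (u, v))"
    unfolding R using E by (simp add: has_bochner_integral_iff)
  show "1 / codim r p m * (\<integral>\<omega>. ?R \<omega> $$ (u, v) \<partial>M) = (if u = v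
      then \<tau> ^ 4 / codim r p m * (slice_kurtosis m u + ?N * (?N * real (p m) - 1)) else 0)"
    unfolding R using E by (simp add: has_bochner_integral_iff)
qed

end

end

section \<open>Recovery of the components of \<open>Z\<close> up to order and sign in each
  mode\<close>

theorem corollary5p4p1:
  fixes M :: "'w measure" and r :: nat and p :: "nat \<Rightarrow> nat"
    and Z X Xst :: "'w \<Rightarrow> tensor" and \<beta> :: tensor
    and \<Omega> D G W :: "nat \<Rightarrow> real mat" and \<tau> :: real
  assumes "prob_space M"
    and "1 \<le> r" and "\<forall>m<r. 1 \<le> p m"
    and \<Omega>: "\<forall>m<r. \<Omega> m \<in> carrier_mat (p m) (p m) \<and> invertible_mat (\<Omega> m)"
    and X: "\<forall>\<omega>\<in>space M. \<forall>i\<in>tensor_idx {..<r} p. X \<omega> i = tensor_mat_prods r (Z \<omega>) \<Omega> i"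
    and indep: "prob_space.indep_vars M (\<lambda>_. borel) (\<lambda>i \<omega>. Z \<omega> i) (tensor_idx {..<r} p)"
    and mean: "\<forall>i\<in>tensor_idx {..<r} p. prob_space.expectation M (\<lambda>\<omega>. Z \<omega> i) = 0"
    and var: "\<forall>i\<in>tensor_idx {..<r} p. prob_space.variance M (\<lambda>\<omega>. Z \<omega> i) = 1"
    and fourth: "\<forall>i\<in>tensor_idx {..<r} p. integrable M (\<lambda>\<omega>. Z \<omega> i ^ 4)"
    and \<beta>: "\<forall>i\<in>tensor_idx {..<r} p. \<beta> i = prob_space.expectation M (\<lambda>\<omega>. Z \<omega> i ^ 4)"
    and distinct: "\<forall>m<r. inj_on (\<lambda>k. vec_index (mode_mean r p m \<beta>) k) {..<p m}"
    and G: "\<forall>m<r. is_inverse_sqrt (p m) (mode_cov M r p m X) (G m)"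
    and Xst: "\<forall>\<omega>\<in>space M. \<forall>i\<in>tensor_idx {..<r} p. Xst \<omega> i = tensor_mat_prods r (X \<omega>) G i"
    and W: "\<forall>m<r. is_orthogonal_mat (p m) (W m) \<and>
      (columns_eigenvectors (mode_B0 M r p m Xst) (W m) \<or>
       columns_eigenvectors (mode_B1 M r p m Xst) (W m))"
    and D: "\<forall>m<r. is_singular_value_mat (p m) (\<Omega> m) (D m)"
    and \<tau>: "\<tau> = (\<Prod>m<r. \<Prod>s\<in>{..<r} - {m}. sqrt (real (p s)) / mat_frob (D s))"
  shows "\<exists>P J. (\<forall>m<r. is_permutation_mat (p m) (P m) \<and> is_sign_mat (p m) (J m)) \<and>
    (\<forall>\<omega>\<in>space M. \<forall>i\<in>tensor_idx {..<r} p.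
      tensor_mat_prods r (X \<omega>) (\<lambda>m. (W m)\<^sup>T * G m) i =
      tensor_mat_prods r (\<lambda>k. \<tau> * Z \<omega> k) (\<lambda>m. P m * J m) i)"
proof -
  interpret prob_space M by fact
  interpret standardized_tensor M r p Z
    using indep mean var fourth by unfold_locales auto
  \<comment> \<open>\<open>a m\<close> is the factor of \<open>\<tau>\<close> belonging to mode
    \<open>m\<close>; its inverse square is the scalar in the covariance, which makes
    \<open>U m\<close> below orthogonal.\<close>
  define a where "a m = (\<Prod>s\<in>{..<r} - {m}. sqrt (real (p s)) / mat_frob (D s))" for m
  define U where "U m = (1 / a m) \<cdot>\<^sub>m (G m * \<Omega> m)" for m
  have \<Omega>c: "\<Omega> m \<in> carrier_mat (p m) (p m)" and Gc: "G m \<in> carrier_mat (p m) (p m)"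
    and Wo: "is_orthogonal_mat (p m) (W m)" if "m < r" for m
    using \<Omega> G W that unfolding is_inverse_sqrt_def by auto
  have frob: "mat_frob (D m) = mat_frob (\<Omega> m)" "0 < mat_frob (D m)" if "m < r" for m
    using mat_frob_singular_value_mat[of "p m" "\<Omega> m" "D m"] mat_frob_pos[of "\<Omega> m" "p m"]
      D \<Omega> \<open>\<forall>m<r. 1 \<le> p m\<close> that by auto
  \<comment> \<open>The product runs over modes below \<open>r\<close> only, so positivity extends
    to all \<open>m\<close>, as does the rescaling of \<open>G m * \<Omega> m\<close> below.\<close>
  have a_pos: "0 < a m" for m
    unfolding a_def using frob(2) \<open>\<forall>m<r. 1 \<le> p m\<close> by (intro prod_pos) (force simp: Suc_le_eq)
  have \<tau>_eq: "\<tau> = (\<Prod>m<r. a m)" unfolding \<tau> a_def ..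
  then have "\<tau> \<noteq> 0" using a_pos by (simp add: less_imp_neq[symmetric])
  have U: "is_orthogonal_mat (p m) (U m)" if m: "m < r" for m
  proof -
    have "(\<Prod>n\<in>{..<r} - {m}. (mat_frob (\<Omega> n))\<^sup>2) / codim r p m = 1 / (a m)\<^sup>2"
      unfolding a_def codim_def by (simp add: frob(1) power_divide prod_power_distrib prod_dividef)
    then have "mode_cov M r p m X = (1 / (a m)\<^sup>2) \<cdot>\<^sub>m (\<Omega> m * (\<Omega> m)\<^sup>T)"
      using mode_cov_tensor_mat_prods[OF m \<Omega>c, of X] X by simp
    then show ?thesis
      unfolding U_def using G m \<Omega>c by (intro is_orthogonal_whitening) auto
  qed
  have G\<Omega>: "G m * \<Omega> m = a m \<cdot>\<^sub>m U m" for m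
    using a_pos[of m] unfolding U_def by (intro eq_matI) auto
  \<comment> \<open>The two successive transformations merge: the scalars \<open>a m\<close> of all
    modes gather in \<open>\<tau>\<close>, and the rotations \<open>U\<close> remain.\<close>
  have Xst': "Xst \<omega> i = tensor_mat_prods r (\<lambda>k. \<tau> * Z \<omega> k) U i"
    if "\<omega> \<in> space M" "i \<in> tensor_idx {..<r} p" for \<omega> i
  proof -
    have "Xst \<omega> i = tensor_mat_prods r (X \<omega>) G i" using Xst that by blast
    also have "\<dots> = tensor_mat_prods r (Z \<omega>) (\<lambda>m. G m * \<Omega> m) i"
      using X \<Omega>c Gc that by (intro tensor_mat_prods_compose[where q = p and s = p]) auto
    also have "\<dots> = tensor_mat_prods r (\<lambda>k. \<tau> * Z \<omega> k) U i"
      unfolding G\<Omega> \<tau>_eq using is_orthogonal_matD(1)[OF U] that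
      by (intro tensor_mat_prods_smult[symmetric]) auto
    finally show ?thesis .
  qed
  have "\<exists>P J. is_permutation_mat (p m) P \<and> is_sign_mat (p m) J \<and> (W m)\<^sup>T * U m = P * J"
    if m: "m < r" for m
  proof -
    have codim_pos: "0 < codim r p m"
      using \<open>\<forall>m<r. 1 \<le> p m\<close> unfolding codim_def by (intro prod_pos) (force simp: Suc_le_eq)
    have "mode_mean r p m \<beta> $ k = slice_kurtosis m k / codim r p m" if "k < p m" for k
      unfolding index_mode_mean[OF m, of k p, OF that] slice_kurtosis_def
      using \<beta> m that by (intro arg_cong2[where f = "(/)"] sum.cong refl) (auto intro: tensor_idx_upd)
    \<comment> \<open>As a positive multiple of the mode means, \<open>slice_kurtosis m\<close>
      inherits their distinctness, and so does its affine image with the nonzero slope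
      \<open>\<tau> ^ 4 / codim r p m\<close>.\<close>
    then have "inj_on (slice_kurtosis m) {..<p m}"
      using distinct m by (force simp: inj_on_def)
    then have inj: "inj_on (\<lambda>i. \<tau> ^ 4 / codim r p m * (slice_kurtosis m i + K)) {..<p m}" for K
      using codim_pos \<open>\<tau> \<noteq> 0\<close> by (auto simp: inj_on_def)
    \<comment> \<open>The two matrices differ only in the shift, so either choice of eigenvectors is
      handled alike.\<close>
    obtain K0 K1 where
      "mode_B0 M r p m Xst = U m * mat (p m) (p m) (\<lambda>(i, j). if i = j
        then \<tau> ^ 4 / codim r p m * (slice_kurtosis m i + K0) else 0) * (U m)\<^sup>T"
      "mode_B1 M r p m Xst = U m * mat (p m) (p m) (\<lambda>(i, j). if i = j
        then \<tau> ^ 4 / codim r p m * (slice_kurtosis m i + K1) else 0) * (U m)\<^sup>T"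
      using mode_B0_diagonalized[OF m U Xst'] mode_B1_diagonalized[OF m U Xst'] by blast
    moreover have "columns_eigenvectors (mode_B0 M r p m Xst) (W m) \<or>
        columns_eigenvectors (mode_B1 M r p m Xst) (W m)"
      using W m by blast
    ultimately show ?thesis
      using eigenvectors_of_diagonalized[OF U[OF m] Wo[OF m] _ inj] by blast
  qed
  then obtain P J where PJ: "\<And>m. m < r \<Longrightarrow>
      is_permutation_mat (p m) (P m) \<and> is_sign_mat (p m) (J m) \<and> (W m)\<^sup>T * U m = P m * J m"
    by metis
  \<comment> \<open>Mode \<open>m\<close> applies \<open>(W m)\<^sup>T * G m * \<Omega> m\<close> to
    \<open>Z\<close>, which is \<open>a m\<close> times a signed permutation matrix. The equality
    holds at every \<open>\<omega>\<close>, not only almost surely.\<close>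
  have "tensor_mat_prods r (X \<omega>) (\<lambda>m. (W m)\<^sup>T * G m) i =
      tensor_mat_prods r (\<lambda>k. \<tau> * Z \<omega> k) (\<lambda>m. P m * J m) i"
    if "\<omega> \<in> space M" and i: "i \<in> tensor_idx {..<r} p" for \<omega> i
  proof -
    note Wc = is_orthogonal_matD(1)[OF Wo] and Uc = is_orthogonal_matD(1)[OF U]
    have WU: "(W m)\<^sup>T * U m \<in> carrier_mat (p m) (p m)" if "m < r" for m
      using Wc[OF that] Uc[OF that] by auto
    have factor: "(W m)\<^sup>T * G m * \<Omega> m = a m \<cdot>\<^sub>m ((W m)\<^sup>T * U m)" if "m < r" for m
    proof -
      have "(W m)\<^sup>T * G m * \<Omega> m = (W m)\<^sup>T * (G m * \<Omega> m)"
        using Wc[OF that] Gc[OF that] \<Omega>c[OF that] by (intro assoc_mult_mat[of _ "p m" "p m" _ "p m" _ "p m"]) auto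
      also have "\<dots> = a m \<cdot>\<^sub>m ((W m)\<^sup>T * U m)"
        unfolding G\<Omega> using Wc[OF that] Uc[OF that]
        by (intro mult_smult_distrib[of _ "p m" "p m" _ "p m"]) auto
      finally show ?thesis .
    qed
    have "tensor_mat_prods r (X \<omega>) (\<lambda>m. (W m)\<^sup>T * G m) i =
        tensor_mat_prods r (Z \<omega>) (\<lambda>m. (W m)\<^sup>T * G m * \<Omega> m) i"
      using X \<Omega>c Gc Wc that
      by (intro tensor_mat_prods_compose[where q = p and s = p] mult_carrier_mat[where n = "p _"]) auto
    also have "\<dots> = tensor_mat_prods r (Z \<omega>) (\<lambda>m. a m \<cdot>\<^sub>m ((W m)\<^sup>T * U m)) i"
      using factor by (simp cong: tensor_mat_prods_cong)
    also have "\<dots> = tensor_mat_prods r (\<lambda>k. \<tau> * Z \<omega> k) (\<lambda>m. (W m)\<^sup>T * U m) i"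
      unfolding \<tau>_eq by (rule tensor_mat_prods_smult[OF WU i, symmetric])
    also have "\<dots> = tensor_mat_prods r (\<lambda>k. \<tau> * Z \<omega> k) (\<lambda>m. P m * J m) i"
      using PJ by (simp cong: tensor_mat_prods_cong)
    finally show ?thesis .
  qed
  then show ?thesis using PJ by blast
qed

end
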